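(* Let $X$ be a saturated directed space whose underlying space $|X|$ is Hausdorff and second countable. Then for all $u,v\in|X|$ the quotient map $q_{u,v}:\overrightarrow{\mathcal P}(X)(u,v)\to\overrightarrow{\mathcal T}(X)(u,v)$ from directed paths with fixed endpoints to traces is a trivial q-fibration of spaces, and the trace space $\overrightarrow{\mathcal T}(X)(u,v)$ is $\Delta$-Hausdorff.
   Context: $\mathbb I=[0,1]$. $\mathbf{Top}$ denotes one of the following two categories (the statement is asserted for each choice): the category of $\Delta$-generated spaces (spaces whose topology is final with respect to all continuous maps from standard topological simplices), or its full subcategory of $\Delta$-Hausdorff spaces ($Y$ is $\Delta$-Hausdorff if the image of every continuous map $\mathbb I\to Y$ is closed). For a topological space $Y$, $k_\Delta Y$ is the same set with the final topology with respect to all continuous maps from standard topological simplices to $Y$. A directed space $X=(|X|,dX)$ consists of a space $|X|\in\mathbf{Top}$ and a set $dX$ of continuous maps $\mathbb I\to|X|$ (directed paths) containing all constant paths and closed under precomposition with continuous nondecreasing maps $\mathbb I\to\mathbb I$ and under normalized composition $(x*_Ny)(t)=x(2t)$ for $t\le\frac12$, $y(2t-1)$ for $t\ge\frac12$, when $x(1)=y(0)$. $\mathsf{Rep}_+$ is the monoid of continuous nondecreasing surjections $\mathbb I\to\mathbb I$. $X$ is saturated if for every continuous $x:\mathbb I\to|X|$ and $\phi\in\mathsf{Rep}_+$, $x\circ\phi\in dX$ implies $x\in dX$. For $u,v\in|X|$, $\overrightarrow{\mathcal P}(X)(u,v)=k_\Delta\{x\in dX\mid x(0)=u,\ x(1)=v\}$,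 where the set carries the relative compact-open topology. Trace equivalence is the equivalence relation generated by $x\sim x\circ\phi$, $\phi\in\mathsf{Rep}_+$. The trace space $\overrightarrow{\mathcal T}(X)(u,v)$ is the set of trace equivalence classes with the quotient topology of $\overrightarrow{\mathcal P}(X)(u,v)$, and $q_{u,v}$ is the quotient map. A trivial q-fibration is a map with the right lifting property with respect to the inclusions $\mathsf S^{n-1}\subset\mathsf D^n$ for all $n\ge0$ ($\mathsf S^{-1}=\varnothing$, $\mathsf D^0$ a point), equivalently a Serre fibration that is a weak homotopy equivalence. *)

theory Defs
  imports "HOL-Analysis.Analysis" "HOL-Homology.Simplices"
begin

section \<open>Final topologies and \<Delta>-generated spaces\<close>

definition final_topology :: "'a set \<Rightarrow> ('b topology \<times> ('b \<Rightarrow> 'a)) set \<Rightarrow> 'a topology" where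
  "final_topology S F =
     topology (\<lambda>U. U \<subseteq> S \<and> (\<forall>(Z, f)\<in>F. openin Z {z \<in> topspace Z. f z \<in> U}))"

lemma openin_final_topology:
  "openin (final_topology S F) U \<longleftrightarrow>
     U \<subseteq> S \<and> (\<forall>(Z, f)\<in>F. openin Z {z \<in> topspace Z. f z \<in> U})"
proof -
  have inter: "openin Z {z \<in> topspace Z. f z \<in> U \<inter> V}"
    if "openin Z {z \<in> topspace Z. f z \<in> U}" "openin Z {z \<in> topspace Z. f z \<in> V}"
    for Z :: "'b topology" and f :: "'b \<Rightarrow> 'a" and U V
  proof -
    have "{z \<in> topspace Z. f z \<in> U \<inter> V} = {z \<in> topspace Z. f z \<in> U} \<inter> {z \<in> topspace Z. f z \<in> V}"
      by blast
    then show ?thesis using that by (simp add: openin_Int)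
  qed
  have union: "openin Z {z \<in> topspace Z. f z \<in> \<Union>K}"
    if "\<And>U. U \<in> K \<Longrightarrow> openin Z {z \<in> topspace Z. f z \<in> U}"
    for Z :: "'b topology" and f :: "'b \<Rightarrow> 'a" and K
  proof -
    have "{z \<in> topspace Z. f z \<in> \<Union>K} = \<Union>((\<lambda>U. {z \<in> topspace Z. f z \<in> U}) ` K)"
      by blast
    then show ?thesis using that by auto
  qed
  have "istopology (\<lambda>U. U \<subseteq> S \<and> (\<forall>(Z, f)\<in>F. openin Z {z \<in> topspace Z. f z \<in> U}))"
    unfolding istopology_def
  proof (intro conjI allI impI)
    fix U V
    assume "U \<subseteq> S \<and> (\<forall>(Z, f)\<in>F. openin Z {z \<in> topspace Z. f z \<in> U})"
       and "V \<subseteq> S \<and> (\<forall>(Z, f)\<in>F. openin Z {z \<in> topspace Z. f z \<in> V})"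
    then show "U \<inter> V \<subseteq> S" and "\<forall>(Z, f)\<in>F. openin Z {z \<in> topspace Z. f z \<in> U \<inter> V}"
      by (fast, intro ballI, clarify, intro inter, auto)
  next
    fix K
    assume "\<forall>U\<in>K. U \<subseteq> S \<and> (\<forall>(Z, f)\<in>F. openin Z {z \<in> topspace Z. f z \<in> U})"
    then show "\<Union>K \<subseteq> S" and "\<forall>(Z, f)\<in>F. openin Z {z \<in> topspace Z. f z \<in> \<Union>K}"
      by (fast, intro ballI, clarify, intro union, auto)
  qed
  then show ?thesis
    by (simp add: final_topology_def topology_inverse')
qed

lemma topspace_final_topology:
  assumes "\<And>Z f. (Z, f) \<in> F \<Longrightarrow> f ` topspace Z \<subseteq> S"
  shows "topspace (final_topology S F) = S"
proof
  show "topspace (final_topology S F) \<subseteq> S"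
    using openin_topspace[of "final_topology S F"] unfolding openin_final_topology by (rule conjunct1)
  have "{z \<in> topspace Z. f z \<in> S} = topspace Z" if "(Z, f) \<in> F" for Z f
    using assms[OF that] by blast
  then have "openin (final_topology S F) S"
    by (auto simp: openin_final_topology)
  then show "S \<subseteq> topspace (final_topology S F)"
    by (rule openin_subset)
qed

abbreviation simplex_space :: "nat \<Rightarrow> (nat \<Rightarrow> real) topology" where
  "simplex_space n \<equiv> subtopology (powertop_real UNIV) (standard_simplex n)"

definition k_Delta :: "'a topology \<Rightarrow> 'a topology" where
  "k_Delta Y = final_topology (topspace Y)
     {(simplex_space n, f) | n f. continuous_map (simplex_space n) Y f}"

definition Delta_generated :: "'a topology \<Rightarrow> bool" where
  "Delta_generated Y \<longleftrightarrow> k_Delta Y = Y"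

definition Delta_Hausdorff :: "'a topology \<Rightarrow> bool" where
  "Delta_Hausdorff Y \<longleftrightarrow> (\<forall>\<gamma>. pathin Y \<gamma> \<longrightarrow> closedin Y (\<gamma> ` {0..1}))"

text \<open>The two admissible choices for the category of spaces, both full subcategories of
  topological spaces, and their objects.\<close>

datatype top_category = Delta_generated_spaces | Delta_Hausdorff_spaces

fun Top_obj :: "top_category \<Rightarrow> 'a topology \<Rightarrow> bool" where
  "Top_obj Delta_generated_spaces Y \<longleftrightarrow> Delta_generated Y"
| "Top_obj Delta_Hausdorff_spaces Y \<longleftrightarrow> Delta_generated Y \<and> Delta_Hausdorff Y"


section \<open>Directed spaces\<close>

text \<open>A map on the unit interval is represented by the function that is \<^term>\<open>undefined\<close>
  outside \<open>{0..1}\<close>, so that equality of functions is equality of maps.\<close>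

definition paths_in :: "'a topology \<Rightarrow> (real \<Rightarrow> 'a) set" where
  "paths_in Y = {x \<in> extensional {0..1}. pathin Y x}"

definition normalized_composition :: "(real \<Rightarrow> 'a) \<Rightarrow> (real \<Rightarrow> 'a) \<Rightarrow> real \<Rightarrow> 'a" where
  "normalized_composition x y =
     restrict (\<lambda>t. if t \<le> 1/2 then x (2 * t) else y (2 * t - 1)) {0..1}"

record 'a dspace =
  uspace :: "'a topology"
  dpaths :: "(real \<Rightarrow> 'a) set"

definition directed_space :: "top_category \<Rightarrow> 'a dspace \<Rightarrow> bool" where
  "directed_space c X \<longleftrightarrow>
     Top_obj c (uspace X) \<and>
     dpaths X \<subseteq> paths_in (uspace X) \<and>
     (\<forall>a \<in> topspace (uspace X). restrict (\<lambda>t. a) {0..1} \<in> dpaths X) \<and>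
     (\<forall>x \<in> dpaths X. \<forall>\<phi> :: real \<Rightarrow> real.
        continuous_on {0..1} \<phi> \<and> mono_on {0..1} \<phi> \<and> \<phi> ` {0..1} \<subseteq> {0..1} \<longrightarrow>
        compose {0..1} x \<phi> \<in> dpaths X) \<and>
     (\<forall>x \<in> dpaths X. \<forall>y \<in> dpaths X. x 1 = y 0 \<longrightarrow> normalized_composition x y \<in> dpaths X)"

definition Rep_plus :: "(real \<Rightarrow> real) set" where
  "Rep_plus = {\<phi> \<in> extensional {0..1}.
     continuous_on {0..1} \<phi> \<and> mono_on {0..1} \<phi> \<and> \<phi> ` {0..1} = {0..1}}"

definition saturated :: "'a dspace \<Rightarrow> bool" where
  "saturated X \<longleftrightarrow>
     (\<forall>x \<in> paths_in (uspace X). \<forall>\<phi> \<in> Rep_plus. compose {0..1} x \<phi> \<in> dpaths X \<longrightarrow> x \<in> dpaths X)"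


section \<open>Path spaces and trace spaces\<close>

text \<open>Taking \<open>K = {}\<close> shows that the topology below has underlying set \<^term>\<open>paths_in Y\<close>.\<close>

definition compact_open_topology :: "'a topology \<Rightarrow> (real \<Rightarrow> 'a) topology" where
  "compact_open_topology Y = topology_generated_by
     {{x \<in> paths_in Y. x ` K \<subseteq> U} | K U. compact K \<and> K \<subseteq> {0..1} \<and> openin Y U}"

definition dpaths_between :: "'a dspace \<Rightarrow> 'a \<Rightarrow> 'a \<Rightarrow> (real \<Rightarrow> 'a) set" where
  "dpaths_between X u v = {x \<in> dpaths X. x 0 = u \<and> x 1 = v}"

definition dpath_space :: "'a dspace \<Rightarrow> 'a \<Rightarrow> 'a \<Rightarrow> (real \<Rightarrow> 'a) topology" where
  "dpath_space X u v =
     k_Delta (subtopology (compact_open_topology (uspace X)) (dpaths_between X u v))"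

definition trace_equivalent :: "'a dspace \<Rightarrow> (real \<Rightarrow> 'a) \<Rightarrow> (real \<Rightarrow> 'a) \<Rightarrow> bool" where
  "trace_equivalent X =
     equivclp (\<lambda>x y. x \<in> dpaths X \<and> (\<exists>\<phi> \<in> Rep_plus. y = compose {0..1} x \<phi>))"

text \<open>A trace is an equivalence class of directed paths. Reparametrizing by an element of
  \<^term>\<open>Rep_plus\<close> preserves endpoints and directedness, so the class of a path in
  \<^term>\<open>dpaths_between X u v\<close> is contained in that set.\<close>

definition trace_of :: "'a dspace \<Rightarrow> 'a \<Rightarrow> 'a \<Rightarrow> (real \<Rightarrow> 'a) \<Rightarrow> (real \<Rightarrow> 'a) set" where
  "trace_of X u v x = {y \<in> dpaths_between X u v. trace_equivalent X x y}"

definition trace_space :: "'a dspace \<Rightarrow> 'a \<Rightarrow> 'a \<Rightarrow> (real \<Rightarrow> 'a) set topology" where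
  "trace_space X u v =
     final_topology (trace_of X u v ` dpaths_between X u v) {(dpath_space X u v, trace_of X u v)}"


section \<open>Trivial q-fibrations\<close>

text \<open>For \<open>n = 0\<close> the sphere is empty and the disk is a point; for \<open>n > 0\<close> the sphere
  \<open>boundary_sphere n\<close> is \<^term>\<open>nsphere (n - 1)\<close>.\<close>

definition disk :: "nat \<Rightarrow> (nat \<Rightarrow> real) topology" where
  "disk n = subtopology (Euclidean_space n) {x. (\<Sum>i<n. (x i)\<^sup>2) \<le> 1}"

definition boundary_sphere :: "nat \<Rightarrow> (nat \<Rightarrow> real) topology" where
  "boundary_sphere n = subtopology (Euclidean_space n) {x. (\<Sum>i<n. (x i)\<^sup>2) = 1}"

definition right_lifting_property ::
  "'e topology \<Rightarrow> 'b topology \<Rightarrow> ('e \<Rightarrow> 'b) \<Rightarrow> 'c topology \<Rightarrow> 'd topology \<Rightarrow> ('c \<Rightarrow> 'd) \<Rightarrow> bool" where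
  "right_lifting_property E B p C D i \<longleftrightarrow>
     (\<forall>g h. continuous_map C E g \<and> continuous_map D B h \<and>
            (\<forall>z \<in> topspace C. p (g z) = h (i z)) \<longrightarrow>
        (\<exists>l. continuous_map D E l \<and>
             (\<forall>z \<in> topspace C. l (i z) = g z) \<and> (\<forall>w \<in> topspace D. p (l w) = h w)))"

definition trivial_q_fibration ::
  "top_category \<Rightarrow> 'e topology \<Rightarrow> 'b topology \<Rightarrow> ('e \<Rightarrow> 'b) \<Rightarrow> bool" where
  "trivial_q_fibration c E B p \<longleftrightarrow>
     Top_obj c E \<and> Top_obj c B \<and> continuous_map E B p \<and>
     (\<forall>n. right_lifting_property E B p (boundary_sphere n) (disk n) (\<lambda>z. z))"

end

theory Submission
  imports Defs
begin

text \<open>On paths in a compact metrizable space, Morse's length (a weighted sum over \<open>n\<close> of the largest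
  \<open>\<delta>\<close> such that the path makes \<open>n\<close> successive jumps of size at least \<open>\<delta>\<close>) is continuous,
  invariant under reparametrization, and constant exactly where the path is constant. Normalizing it
  gives for every path \<open>x\<close> a factorization \<open>x = N x \<circ> \<phi>\<close> in which the natural path \<open>N x\<close> depends
  only on the trace of \<open>x\<close> and continuously on \<open>x\<close>.

  The space \<open>|X|\<close> need not be metrizable. But saturation of sets of paths under trace equivalence
  preserves openness, so for a continuous map \<open>h\<close> from a compact space to the trace space the images
  of all traces \<open>h w\<close> fill a compact, hence metrizable, subspace of \<open>|X|\<close>. Natural paths in it
  provide a continuous lift \<open>s\<close> of \<open>h\<close>. A given lift \<open>g\<close> over the boundary of a disk has the form
  \<open>s z \<circ> \<phi>\<^sub>z\<close>, and \<open>s w \<circ> \<Phi>\<^sub>w\<close> extends it, where \<open>\<Phi>\<close> contracts \<open>\<phi>\<close> to the identity by convex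
  combination along radii; the contraction is done before normalizing, which keeps it under control
  where \<open>g\<close> is a constant path.\<close>

section \<open>Morse's path length\<close>

text \<open>Arc length cannot serve as the parameter: paths need not be rectifiable, and arc length
  is only semicontinuous under uniform convergence. Jump sizes change by at most twice the uniform
  distance, whence continuity; but for one fixed \<open>n\<close> the largest jump can stagnate
  while the path moves, so all \<open>n\<close> are summed. A second countable Hausdorff space can
  fail to be regular, so metrizability is sought on compact subsets. These suffice because lifting
  is tested on disks and \<open>k_Delta\<close> on simplices, both compact. The delicate points are
  constant paths: their total length is zero, and normalized parameters of nearby paths need not
  converge there. The continuity proofs for natural paths and for the extended lift therefore split.
  At a constant path the whole image already lies in the given open set, so any parameter will do;
  elsewhere division by the total length is stable.\<close>

text \<open>A chain is a total monotone sequence of which only the first \<open>n\<close> steps are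
  tested; this avoids index bounds when chains are moved around. The cap
  \<open>\<delta> \<le> 1\<close> keeps the set bounded also for \<open>n = 0\<close>, where the
  condition on jumps is vacuous.\<close>

definition jump_sizes :: "(real \<Rightarrow> 'm::metric_space) \<Rightarrow> nat \<Rightarrow> real \<Rightarrow> real set" where
  "jump_sizes x n t = {\<delta>. 0 \<le> \<delta> \<and> \<delta> \<le> 1 \<and>
     (\<exists>\<tau>. mono \<tau> \<and> (\<forall>i. \<tau> i \<in> {0..t}) \<and> (\<forall>i<n. \<delta> \<le> dist (x (\<tau> i)) (x (\<tau> (Suc i)))))}"

definition max_jump :: "(real \<Rightarrow> 'm::metric_space) \<Rightarrow> nat \<Rightarrow> real \<Rightarrow> real" where
  "max_jump x n t = Sup (jump_sizes x n t)"

text \<open>The sum starts with chains of one jump: for \<open>n = 0\<close> the supremum is 1 even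
  on a constant path. The weights add up to 1, so a uniform error in all \<open>max_jump\<close>
  values passes unchanged to the length.\<close>

definition morse_length :: "(real \<Rightarrow> 'm::metric_space) \<Rightarrow> real \<Rightarrow> real" where
  "morse_length x t = suminf (\<lambda>n. (1/2) ^ Suc n * max_jump x (Suc n) t)"

lemma zero_in_jump_sizes: "t \<ge> 0 \<Longrightarrow> 0 \<in> jump_sizes x n t"
  unfolding jump_sizes_def by (auto intro!: exI[of _ "\<lambda>_. 0"] simp: mono_def)

lemma bdd_above_jump_sizes: "bdd_above (jump_sizes x n t)"
  unfolding jump_sizes_def by (auto intro!: bdd_aboveI[of _ 1])

lemma jump_sizes_le_max_jump: "\<delta> \<in> jump_sizes x n t \<Longrightarrow> \<delta> \<le> max_jump x n t"
  unfolding max_jump_def by (rule cSup_upper[OF _ bdd_above_jump_sizes])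

lemma max_jump_nonneg: "t \<ge> 0 \<Longrightarrow> 0 \<le> max_jump x n t"
  by (rule jump_sizes_le_max_jump[OF zero_in_jump_sizes])

lemma max_jump_leI:
  assumes "t \<ge> 0" and "\<And>\<delta>. \<delta> \<in> jump_sizes x n t \<Longrightarrow> \<delta> \<le> b"
  shows "max_jump x n t \<le> b"
  unfolding max_jump_def using assms zero_in_jump_sizes[OF assms(1)] by (intro cSup_least) auto

lemma max_jump_le_1: "t \<ge> 0 \<Longrightarrow> max_jump x n t \<le> 1"
  by (rule max_jump_leI) (auto simp: jump_sizes_def)

text \<open>Each of the two ends of a jump moves by at most \<open>\<eta>\<close>. Nearby paths,
  larger intervals, truncated intervals and reparametrizations are all compared by exhibiting the
  chain \<tau>'.\<close>

lemma max_jump_transfer: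
  assumes t: "t \<ge> 0" and t': "t' \<ge> 0" and \<eta>: "\<eta> \<ge> 0"
    and chain: "\<And>\<tau> :: nat \<Rightarrow> real. mono \<tau> \<Longrightarrow> (\<forall>i. \<tau> i \<in> {0..t}) \<Longrightarrow>
      \<exists>\<tau>' :: nat \<Rightarrow> real. mono \<tau>' \<and> (\<forall>i. \<tau>' i \<in> {0..t'}) \<and> (\<forall>i. dist (x (\<tau> i)) (x' (\<tau>' i)) \<le> \<eta>)"
  shows "max_jump x n t \<le> max_jump x' n t' + 2 * \<eta>"
proof (rule max_jump_leI[OF t])
  fix \<delta> assume "\<delta> \<in> jump_sizes x n t"
  then obtain \<tau> where \<delta>: "0 \<le> \<delta>" "\<delta> \<le> 1" and \<tau>: "mono \<tau>" "\<forall>i. \<tau> i \<in> {0..t}"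
    and jump: "\<And>i. i < n \<Longrightarrow> \<delta> \<le> dist (x (\<tau> i)) (x (\<tau> (Suc i)))"
    unfolding jump_sizes_def by blast
  from chain[OF \<tau>] obtain \<tau>' where \<tau>': "mono \<tau>'" "\<forall>i. \<tau>' i \<in> {0..t'}"
    and close: "\<And>i. dist (x (\<tau> i)) (x' (\<tau>' i)) \<le> \<eta>" by blast
  \<comment> \<open>Truncation at 0 keeps the value admissible for \<open>jump_sizes\<close> when
    \<delta> is smaller than the error.\<close>
  have "max 0 (\<delta> - 2 * \<eta>) \<le> dist (x' (\<tau>' i)) (x' (\<tau>' (Suc i)))" if "i < n" for i
  proof -
    have "dist (x (\<tau> i)) (x (\<tau> (Suc i))) \<le>
        dist (x (\<tau> i)) (x' (\<tau>' i)) + dist (x' (\<tau>' i)) (x' (\<tau>' (Suc i))) + dist (x (\<tau> (Suc i))) (x' (\<tau>' (Suc i)))"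
      by metric
    then show ?thesis using jump[OF that] close[of i] close[of "Suc i"] by auto
  qed
  then have "max 0 (\<delta> - 2 * \<eta>) \<in> jump_sizes x' n t'"
    unfolding jump_sizes_def using \<delta> \<eta> \<tau>' by auto
  from jump_sizes_le_max_jump[OF this] show "\<delta> \<le> max_jump x' n t' + 2 * \<eta>" by linarith
qed

lemma sums_half_power: "(\<lambda>n. (1/2) ^ Suc n * c) sums (c::real)"
  using sums_mult2[OF power_half_series] by simp

lemma summable_morse_length:
  "t \<ge> 0 \<Longrightarrow> summable (\<lambda>n. (1/2) ^ Suc n * max_jump x (Suc n) t)"
  by (rule summable_comparison_test'[OF sums_summable[OF sums_half_power[of 1]], of 0])
    (simp add: max_jump_nonneg max_jump_le_1 abs_mult)

lemma morse_length_transfer: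
  assumes t: "t \<ge> 0" and t': "t' \<ge> 0" and "\<eta> \<ge> 0"
    and "\<And>\<tau> :: nat \<Rightarrow> real. mono \<tau> \<Longrightarrow> (\<forall>i. \<tau> i \<in> {0..t}) \<Longrightarrow>
      \<exists>\<tau>' :: nat \<Rightarrow> real. mono \<tau>' \<and> (\<forall>i. \<tau>' i \<in> {0..t'}) \<and> (\<forall>i. dist (x (\<tau> i)) (x' (\<tau>' i)) \<le> \<eta>)"
  shows "morse_length x t \<le> morse_length x' t' + 2 * \<eta>"
proof -
  have "morse_length x t \<le> suminf (\<lambda>n. (1/2) ^ Suc n * max_jump x' (Suc n) t' + (1/2) ^ Suc n * (2 * \<eta>))"
    unfolding morse_length_def
  proof (rule suminf_le[OF _ summable_morse_length[OF t]])
    show "summable (\<lambda>n. (1/2) ^ Suc n * max_jump x' (Suc n) t' + (1/2) ^ Suc n * (2 * \<eta>))"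
      by (intro summable_add summable_morse_length[OF t'] sums_summable[OF sums_half_power])
  next
    fix n
    have "max_jump x (Suc n) t \<le> max_jump x' (Suc n) t' + 2 * \<eta>"
      by (rule max_jump_transfer) (use assms in auto)
    then have "(1/2) ^ Suc n * max_jump x (Suc n) t \<le> (1/2) ^ Suc n * (max_jump x' (Suc n) t' + 2 * \<eta>)"
      by (rule mult_left_mono) simp
    then show "(1/2) ^ Suc n * max_jump x (Suc n) t \<le>
        (1/2) ^ Suc n * max_jump x' (Suc n) t' + (1/2) ^ Suc n * (2 * \<eta>)"
      by (simp add: distrib_left)
  qed
  also have "\<dots> = morse_length x' t' + 2 * \<eta>"
    unfolding morse_length_def
    by (subst suminf_add[OF summable_morse_length[OF t', of x'] sums_summable[OF sums_half_power[of "2 * \<eta>"]], symmetric])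
      (simp only: sums_unique[OF sums_half_power[of "2 * \<eta>"], symmetric])
  finally show ?thesis .
qed

lemma morse_length_nonneg: "t \<ge> 0 \<Longrightarrow> 0 \<le> morse_length x t"
  unfolding morse_length_def
  by (rule suminf_nonneg[OF summable_morse_length]) (auto simp: max_jump_nonneg)

lemma morse_length_le_1: 
  assumes "t \<ge> 0" shows "morse_length x t \<le> 1"
proof -
  have "morse_length x t \<le> suminf (\<lambda>n. (1/2) ^ Suc n * (1::real))"
    unfolding morse_length_def
    by (rule suminf_le[OF _ summable_morse_length[OF assms] sums_summable[OF sums_half_power]])
      (simp add: max_jump_le_1 assms)
  then show ?thesis using sums_unique[OF sums_half_power[of 1]] by simp
qed

lemma max_jump_eq_0_if_const:
  assumes "t \<ge> 0" and "\<And>s. s \<in> {0..t} \<Longrightarrow> x s = p"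
  shows "max_jump x (Suc n) t = 0"
proof (rule antisym[OF max_jump_leI[OF assms(1)] max_jump_nonneg[OF assms(1)]])
  fix \<delta> assume "\<delta> \<in> jump_sizes x (Suc n) t"
  then obtain \<tau> where "\<forall>i. \<tau> i \<in> {0..t}" "\<delta> \<le> dist (x (\<tau> 0)) (x (\<tau> (Suc 0)))"
    unfolding jump_sizes_def by blast
  then show "\<delta> \<le> 0" using assms(2)[of "\<tau> 0"] assms(2)[of "\<tau> (Suc 0)"] by simp
qed

lemma morse_length_eq_0_if_const:
  assumes "t \<ge> 0" and "\<And>s. s \<in> {0..t} \<Longrightarrow> x s = p"
  shows "morse_length x t = 0"
  unfolding morse_length_def using max_jump_eq_0_if_const[OF assms] by simp

lemma morse_length_0 [simp]: "morse_length x 0 = 0"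
  by (rule morse_length_eq_0_if_const) auto

lemma morse_length_close:
  assumes "t \<ge> 0" "\<eta> \<ge> 0" and "\<And>s. s \<in> {0..t} \<Longrightarrow> dist (x s) (x' s) \<le> \<eta>"
  shows "\<bar>morse_length x t - morse_length x' t\<bar> \<le> 2 * \<eta>"
proof -
  have "morse_length x t \<le> morse_length x' t + 2 * \<eta>"
    by (rule morse_length_transfer) (use assms in auto)
  moreover have "morse_length x' t \<le> morse_length x t + 2 * \<eta>"
    by (rule morse_length_transfer) (use assms in \<open>auto simp: dist_commute\<close>)
  ultimately show ?thesis by linarith
qed

lemma max_jump_mono:
  assumes "0 \<le> t" "t \<le> t'"
  shows "max_jump x n t \<le> max_jump x n t'"
proof -
  have "max_jump x n t \<le> max_jump x n t' + 2 * 0"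
  proof (rule max_jump_transfer)
    fix \<tau> :: "nat \<Rightarrow> real" assume \<tau>: "mono \<tau>" "\<forall>i. \<tau> i \<in> {0..t}"
    then show "\<exists>\<tau>'. mono \<tau>' \<and> (\<forall>i. \<tau>' i \<in> {0..t'}) \<and> (\<forall>i. dist (x (\<tau> i)) (x (\<tau>' i)) \<le> 0)"
      using assms by (intro exI[of _ \<tau>]) (auto intro: order_trans)
  qed (use assms in auto)
  then show ?thesis by simp
qed

lemma morse_length_mono:
  assumes "0 \<le> t" "t \<le> t'"
  shows "morse_length x t \<le> morse_length x t'"
  unfolding morse_length_def
  by (intro suminf_le summable_morse_length mult_left_mono max_jump_mono) (use assms in auto)

text \<open>Cutting a chain off at \<open>a\<close> moves only its points beyond \<open>a\<close>,
  and those by at most \<eta> in the image. This bounds the growth of the length over short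
  intervals and yields its continuity in \<open>t\<close>.\<close>

lemma morse_length_oscillation:
  assumes "0 \<le> a" "a \<le> b" "\<eta> \<ge> 0" and "\<And>s. s \<in> {a..b} \<Longrightarrow> dist (x s) (x a) \<le> \<eta>"
  shows "morse_length x b \<le> morse_length x a + 2 * \<eta>"
proof (rule morse_length_transfer)
  fix \<tau> :: "nat \<Rightarrow> real" assume \<tau>: "mono \<tau>" "\<forall>i. \<tau> i \<in> {0..b}"
  show "\<exists>\<tau>'. mono \<tau>' \<and> (\<forall>i. \<tau>' i \<in> {0..a}) \<and> (\<forall>i. dist (x (\<tau> i)) (x (\<tau>' i)) \<le> \<eta>)"
  proof (intro exI[of _ "\<lambda>i. min (\<tau> i) a"] conjI allI)
    show "mono (\<lambda>i. min (\<tau> i) a)" using \<tau>(1) by (fastforce simp: mono_def min_def)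
    show "min (\<tau> i) a \<in> {0..a}" for i using \<tau>(2) assms by (auto simp: min_def)
    show "dist (x (\<tau> i)) (x (min (\<tau> i) a)) \<le> \<eta>" for i
      using assms(3) assms(4)[of "\<tau> i"] \<tau>(2) by (auto simp: min_def)
  qed
qed (use assms in auto)

lemma continuous_on_morse_length:
  assumes x: "continuous_on {0..1} x"
  shows "continuous_on {0..1} (morse_length x)"
  unfolding continuous_on_iff
proof (intro ballI allI impI)
  fix t e :: real assume t: "t \<in> {0..1}" and e: "0 < e"
  obtain d where d: "d > 0" "\<And>s s'. s \<in> {0..1} \<Longrightarrow> s' \<in> {0..1} \<Longrightarrow> dist s' s < d \<Longrightarrow> dist (x s') (x s) < e/4"
    using compact_uniformly_continuous[OF x compact_Icc] e
    unfolding uniformly_continuous_on_def by (metis zero_less_divide_iff zero_less_numeral)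
  have *: "\<bar>morse_length x b - morse_length x a\<bar> \<le> e/2" if "a \<in> {0..1}" "b \<in> {0..1}" "a \<le> b" "b - a < d" for a b
  proof -
    have "dist (x s) (x a) \<le> e/4" if "s \<in> {a..b}" for s
      by (intro less_imp_le d(2)) (use that \<open>a \<in> _\<close> \<open>b \<in> _\<close> \<open>b - a < d\<close> in \<open>auto simp: dist_real_def\<close>)
    then have "morse_length x b \<le> morse_length x a + 2 * (e/4)"
      by (intro morse_length_oscillation) (use that e in auto)
    then show ?thesis using morse_length_mono[of a b x] that by auto
  qed
  show "\<exists>d>0. \<forall>t'\<in>{0..1}. dist t' t < d \<longrightarrow> dist (morse_length x t') (morse_length x t) < e"
  proof (intro exI[of _ d] conjI ballI impI)
    fix t' assume "t' \<in> {0..1}" "dist t' t < d"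
    then have "\<bar>morse_length x t' - morse_length x t\<bar> \<le> e/2"
      using *[of t t'] *[of t' t] t
      by (cases "t \<le> t'") (auto simp: dist_real_def abs_minus_commute[of "morse_length x t'"])
    then show "dist (morse_length x t') (morse_length x t) < e"
      using e by (simp add: dist_real_def)
  qed (use d in auto)
qed

text \<open>Chains of \<open>y\<close> are pushed forward along \<phi>; chains of \<open>x\<close>
  are pulled back along a monotone section of \<phi>. Both operations preserve the jumps
  exactly.\<close>

lemma morse_length_reparametrize:
  assumes cont: "continuous_on {0..1} \<phi>" and mono: "mono_on {0..1} \<phi>" and 0: "\<phi> 0 = 0" and t: "t \<in> {0..1::real}"
    and y: "\<And>s. s \<in> {0..1} \<Longrightarrow> y s = x (\<phi> s)"
  shows "morse_length y t = morse_length x (\<phi> t)"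
proof (rule antisym)
  have pos: "\<phi> s \<ge> 0" if "s \<in> {0..1}" for s
    using mono_onD[OF mono, of 0 s] that 0 by auto
  have "morse_length y t \<le> morse_length x (\<phi> t) + 2 * 0"
  proof (rule morse_length_transfer)
    fix \<tau> :: "nat \<Rightarrow> real" assume \<tau>: "mono \<tau>" "\<forall>i. \<tau> i \<in> {0..t}"
    then have \<tau>1: "\<tau> i \<in> {0..1}" "\<tau> i \<le> t" for i using t by (meson atLeastAtMost_iff order_trans)+
    show "\<exists>\<tau>'. mono \<tau>' \<and> (\<forall>i. \<tau>' i \<in> {0..\<phi> t}) \<and> (\<forall>i. dist (y (\<tau> i)) (x (\<tau>' i)) \<le> 0)"
    proof (intro exI[of _ "\<lambda>i. \<phi> (\<tau> i)"] conjI allI monoI)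
      show "\<phi> (\<tau> i) \<le> \<phi> (\<tau> j)" if "i \<le> j" for i j
        using \<tau>1 monoD[OF \<tau>(1) that] by (intro mono_onD[OF mono])
      show "\<phi> (\<tau> i) \<in> {0..\<phi> t}" for i
        using pos[OF \<tau>1(1)] mono_onD[OF mono \<tau>1(1) t \<tau>1(2)] by simp
    qed (use y \<tau>1 in simp)
  qed (use t pos in auto)
  then show "morse_length y t \<le> morse_length x (\<phi> t)" by simp
  have "morse_length x (\<phi> t) \<le> morse_length y t + 2 * 0"
  proof (rule morse_length_transfer)
    fix \<tau> :: "nat \<Rightarrow> real" assume \<tau>: "mono \<tau>" "\<forall>i. \<tau> i \<in> {0..\<phi> t}"
    have "\<exists>s. s \<in> {0..t} \<and> \<phi> s = r" if "r \<in> {0..\<phi> t}" for r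
      using IVT'[of \<phi> 0 r t] that 0 t continuous_on_subset[OF cont, of "{0..t}"] by force
    \<comment> \<open>Any choice of preimages is monotone because \<phi> is; \<sigma> is in general
      discontinuous where \<phi> has plateaus.\<close>
    then obtain \<sigma> where \<sigma>: "\<And>r. r \<in> {0..\<phi> t} \<Longrightarrow> \<sigma> r \<in> {0..t} \<and> \<phi> (\<sigma> r) = r" by metis
    have "\<sigma> r \<le> \<sigma> r'" if "r \<in> {0..\<phi> t}" "r' \<in> {0..\<phi> t}" "r \<le> r'" for r r'
    proof (rule ccontr)
      assume "\<not> \<sigma> r \<le> \<sigma> r'"
      then have "\<phi> (\<sigma> r') \<le> \<phi> (\<sigma> r)"
        using \<sigma>[OF that(1)] \<sigma>[OF that(2)] t by (intro mono_onD[OF mono]) auto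
      then have "r = r'" using \<sigma> that by fastforce
      then show False using \<open>\<not> \<sigma> r \<le> \<sigma> r'\<close> by simp
    qed
    then have "mono (\<lambda>i. \<sigma> (\<tau> i))" using \<tau> by (simp add: mono_def)
    moreover have "\<forall>i. \<sigma> (\<tau> i) \<in> {0..t}" using \<sigma> \<tau> by blast
    moreover have "\<forall>i. dist (x (\<tau> i)) (y (\<sigma> (\<tau> i))) \<le> 0"
    proof
      fix i
      from \<sigma>[OF spec[OF \<tau>(2)], of i] t have "\<sigma> (\<tau> i) \<in> {0..1}" "\<phi> (\<sigma> (\<tau> i)) = \<tau> i" by auto
      then show "dist (x (\<tau> i)) (y (\<sigma> (\<tau> i))) \<le> 0" using y by simp
    qed
    ultimately show "\<exists>\<tau>'. mono \<tau>' \<and> (\<forall>i. \<tau>' i \<in> {0..t}) \<and> (\<forall>i. dist (x (\<tau> i)) (y (\<tau>' i)) \<le> 0)"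
      by (intro exI[of _ "\<lambda>i. \<sigma> (\<tau> i)"]) simp
  qed (use t pos in auto)
  then show "morse_length x (\<phi> t) \<le> morse_length y t" by simp
qed

text \<open>By uniform continuity a jump larger than \<open>e/2\<close> takes time at least
  \<open>d\<close>, and an interval of length at most 1 has no room for \<open>n > 1/d\<close> of
  them.\<close>

lemma max_jump_small:
  assumes x: "continuous_on {0..1} x" and t: "t \<in> {0..1::real}" and e: "e > 0"
  shows "\<exists>n. max_jump x n t < e"
proof -
  obtain d where d: "d > 0" "\<And>s s'. s \<in> {0..1} \<Longrightarrow> s' \<in> {0..1} \<Longrightarrow> dist s' s < d \<Longrightarrow> dist (x s') (x s) < e/2"
    using compact_uniformly_continuous[OF x compact_Icc] e
    unfolding uniformly_continuous_on_def by (metis zero_less_divide_iff zero_less_numeral)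
  obtain n :: nat where n: "n * d > 1"
    using reals_Archimedean3[OF d(1)] by blast
  have "max_jump x n t \<le> e/2"
  proof (rule max_jump_leI)
    fix \<delta> assume "\<delta> \<in> jump_sizes x n t"
    then obtain \<tau> where \<tau>: "mono \<tau>" "\<forall>i. \<tau> i \<in> {0..t}"
      and jump: "\<And>i. i < n \<Longrightarrow> \<delta> \<le> dist (x (\<tau> i)) (x (\<tau> (Suc i)))"
      unfolding jump_sizes_def by blast
    show "\<delta> \<le> e/2"
    proof (rule ccontr)
      assume "\<not> \<delta> \<le> e/2"
      have step: "\<tau> i + d \<le> \<tau> (Suc i)" if "i < n" for i
      proof (rule ccontr)
        assume "\<not> \<tau> i + d \<le> \<tau> (Suc i)"
        moreover have "\<tau> i \<le> \<tau> (Suc i)" using \<tau>(1) by (simp add: mono_def)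
        moreover have "\<tau> i \<in> {0..1}" "\<tau> (Suc i) \<in> {0..1}" using \<tau>(2) t by (meson atLeastAtMost_iff order_trans)+
        ultimately have "dist (x (\<tau> i)) (x (\<tau> (Suc i))) < e/2"
          by (intro d(2)) (auto simp: dist_real_def)
        then show False using jump[OF that] \<open>\<not> \<delta> \<le> e/2\<close> by simp
      qed
      have "\<tau> 0 + k * d \<le> \<tau> k" if "k \<le> n" for k :: nat
        using that
      proof (induction k)
        case (Suc k)
        then show ?case using step[of k] by (simp add: algebra_simps)
      qed simp
      from this[of n] n have "\<tau> n > 1" using \<tau>(2) by (smt (verit) atLeastAtMost_iff order_refl)
      then show False using \<tau>(2) t by (smt (verit) atLeastAtMost_iff)
    qed
  qed (use t in auto)
  then show ?thesis using e by (intro exI[of _ n]) simp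
qed

text \<open>Let \<open>n\<close> be minimal such that chains of \<open>n\<close> jumps in \<open>[0,a]\<close> have minimal jump below half the
  size of the jump from \<open>a\<close> to \<open>c\<close>. A chain with one jump less then continues to \<open>a\<close> or to \<open>c\<close>.\<close>

lemma morse_length_strict:
  assumes x: "continuous_on {0..1} x" and ac: "0 \<le> a" "a \<le> c" "c \<le> 1" and ne: "x a \<noteq> x c"
  shows "morse_length x a < morse_length x c"
proof -
  \<comment> \<open>By the triangle inequality every point is at distance at least \<open>e\<close>
    from \<open>x a\<close> or from \<open>x c\<close>. The bound \<open>e \<le> 1/2\<close>
    excludes \<open>n = 0\<close>, where the largest jump is 1.\<close>
  define e where "e = min 1 (dist (x a) (x c)) / 2"
  have e: "e > 0" "e \<le> 1/2" "2 * e \<le> dist (x a) (x c)" using ne by (auto simp: e_def)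
  define n where "n = (LEAST n. max_jump x n a < e)"
  have n: "max_jump x n a < e"
    unfolding n_def by (rule LeastI_ex[OF max_jump_small[OF x]]) (use ac e in auto)
  have "1 \<in> jump_sizes x 0 a"
    unfolding jump_sizes_def using ac by (auto intro!: exI[of _ "\<lambda>_. 0"] simp: mono_def)
  then have "1 \<le> max_jump x 0 a" by (rule jump_sizes_le_max_jump)
  then have "n \<noteq> 0" using n e by (intro notI) auto
  then obtain m where m: "n = Suc m" by (cases n) auto
  have "\<not> max_jump x m a < e" using not_less_Least[of m "\<lambda>n. max_jump x n a < e"] m n_def by auto
  then have "max_jump x n a < max_jump x m a" using n by simp
  \<comment> \<open>Both \<delta> and \<open>e\<close> exceed \<open>max_jump x n a\<close>, so a
    chain with \<open>n\<close> jumps of size \<open>min \<delta> e\<close> is a strict gain in the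
    term of index \<open>m\<close>; no other term decreases.\<close>
  then obtain \<delta> where "\<delta> \<in> jump_sizes x m a" and \<delta>: "max_jump x n a < \<delta>"
    unfolding max_jump_def[of x m a] using zero_in_jump_sizes[OF ac(1), of x m]
    by (subst (asm) less_cSup_iff[OF _ bdd_above_jump_sizes]) auto
  then obtain \<tau> where \<delta>1: "0 \<le> \<delta>" "\<delta> \<le> 1" and \<tau>: "mono \<tau>" "\<forall>i. \<tau> i \<in> {0..a}"
    and jump: "\<And>i. i < m \<Longrightarrow> \<delta> \<le> dist (x (\<tau> i)) (x (\<tau> (Suc i)))"
    unfolding jump_sizes_def by blast
  have "dist (x a) (x c) \<le> dist (x (\<tau> m)) (x a) + dist (x (\<tau> m)) (x c)" by metric
  then obtain c' where c': "c' = a \<or> c' = c" "e \<le> dist (x (\<tau> m)) (x c')"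
    using e by (cases "e \<le> dist (x (\<tau> m)) (x a)") (auto intro: that)
  define \<tau>' where "\<tau>' i = (if i \<le> m then \<tau> i else c')" for i
  have in_a: "0 \<le> \<tau> i" "\<tau> i \<le> a" for i using \<tau>(2) by auto
  have c'_bounds: "a \<le> c'" "c' \<le> c" using c'(1) ac by auto
  have "mono \<tau>'"
  proof (rule monoI)
    fix i j :: nat assume "i \<le> j"
    then show "\<tau>' i \<le> \<tau>' j"
      using monoD[OF \<tau>(1), of i j] order_trans[OF in_a(2) c'_bounds(1)] by (simp add: \<tau>'_def)
  qed
  moreover have "\<forall>i. \<tau>' i \<in> {0..c}"
  proof
    show "\<tau>' i \<in> {0..c}" for i using in_a[of i] c'_bounds ac by (simp add: \<tau>'_def)
  qed
  moreover have "min \<delta> e \<le> dist (x (\<tau>' i)) (x (\<tau>' (Suc i)))" if "i < n" for i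
    using that m jump[of i] c'(2) by (cases "i = m") (auto simp: \<tau>'_def)
  ultimately have "min \<delta> e \<in> jump_sizes x n c"
    unfolding jump_sizes_def using \<delta>1 e by auto
  then have "min \<delta> e \<le> max_jump x n c" by (rule jump_sizes_le_max_jump)
  then have lt: "max_jump x (Suc m) a < max_jump x (Suc m) c" using n \<delta> m by auto
  let ?f = "\<lambda>t n. (1/2) ^ Suc n * max_jump x (Suc n) t"
  have summable: "summable (?f a)" "summable (?f c)" 
    by (rule summable_morse_length, use ac in linarith)+
  have "0 < suminf (\<lambda>i. ?f c i - ?f a i)"
  proof (rule suminf_pos2[of _ m])
    show "summable (\<lambda>i. ?f c i - ?f a i)" by (rule summable_diff[OF summable(2,1)])
    show "0 \<le> ?f c i - ?f a i" for i
      using max_jump_mono[OF ac(1,2), of x "Suc i"] by (simp add: mult_left_mono)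
    show "0 < ?f c m - ?f a m" using lt by simp
  qed
  then show ?thesis
    unfolding morse_length_def using suminf_diff[OF summable(2,1)] by simp
qed

lemma morse_length_eq_imp_const:
  assumes x: "continuous_on {0..1} x" and "0 \<le> a" "a \<le> b" "b \<le> 1"
    and "morse_length x a = morse_length x b" and "c \<in> {a..b}"
  shows "x c = x a"
proof (rule ccontr)
  assume "x c \<noteq> x a"
  then have "morse_length x a < morse_length x c"
    by (intro morse_length_strict[OF x]) (use assms in auto)
  moreover have "morse_length x c \<le> morse_length x b"
    by (rule morse_length_mono) (use assms in auto)
  ultimately show False using assms by simp
qed

section \<open>The compact-open topology and reparametrizations\<close>

lemma topspace_compact_open: "topspace (compact_open_topology Y) = paths_in Y"
proof -
  have "\<Union>{{x \<in> paths_in Y. x ` K \<subseteq> U} | K U. compact K \<and> K \<subseteq> {0..1} \<and> openin Y U} = paths_in Y"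
  proof (intro equalityI subsetI)
    fix x assume "x \<in> paths_in Y"
    then have "x \<in> {x \<in> paths_in Y. x ` {} \<subseteq> {}}" by simp
    moreover have "{x \<in> paths_in Y. x ` {} \<subseteq> {}} \<in> {{x \<in> paths_in Y. x ` K \<subseteq> U} | K U. compact K \<and> K \<subseteq> {0..1} \<and> openin Y U}"
      by (intro CollectI exI[of _ "{}"]) auto
    ultimately show "x \<in> \<Union>{{x \<in> paths_in Y. x ` K \<subseteq> U} | K U. compact K \<and> K \<subseteq> {0..1} \<and> openin Y U}"
      by blast
  qed blast
  then show ?thesis
    unfolding compact_open_topology_def by (simp add: topology_generated_by_topspace)
qed

lemma openin_compact_open_subbasic:
  assumes "compact K" "K \<subseteq> {0..1}" "openin Y U"
  shows "openin (compact_open_topology Y) {x \<in> paths_in Y. x ` K \<subseteq> U}"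
  unfolding compact_open_topology_def
  by (rule topology_generated_by_Basis) (use assms in blast)

lemma continuous_map_into_compact_open:
  assumes "f ` topspace Z \<subseteq> paths_in Y"
    and "\<And>K U. \<lbrakk>compact K; K \<subseteq> {0..1}; openin Y U\<rbrakk> \<Longrightarrow> openin Z {z \<in> topspace Z. f z ` K \<subseteq> U}"
  shows "continuous_map Z (compact_open_topology Y) f"
  unfolding compact_open_topology_def
proof (rule continuous_on_generated_topo)
  fix W assume "W \<in> {{x \<in> paths_in Y. x ` K \<subseteq> U} | K U. compact K \<and> K \<subseteq> {0..1} \<and> openin Y U}"
  then obtain K U where KU: "compact K" "K \<subseteq> {0..1}" "openin Y U" and W: "W = {x \<in> paths_in Y. x ` K \<subseteq> U}"
    by blast
  have "f -` W \<inter> topspace Z = {z \<in> topspace Z. f z ` K \<subseteq> U}"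
    using assms(1) W by blast
  then show "openin Z (f -` W \<inter> topspace Z)" using assms(2)[OF KU] by simp
next
  show "f ` topspace Z \<subseteq> \<Union>{{x \<in> paths_in Y. x ` K \<subseteq> U} | K U. compact K \<and> K \<subseteq> {0..1} \<and> openin Y U}"
    using assms(1) topspace_compact_open[of Y]
    unfolding compact_open_topology_def by (simp add: topology_generated_by_topspace)
qed

lemma paths_in_range: "x \<in> paths_in Y \<Longrightarrow> t \<in> {0..1} \<Longrightarrow> x t \<in> topspace Y"
  unfolding paths_in_def pathin_def continuous_map_def by (auto simp: Pi_iff)

lemma paths_in_ext: "x \<in> paths_in Y \<Longrightarrow> y \<in> paths_in Y' \<Longrightarrow> (\<And>t. t \<in> {0..1} \<Longrightarrow> x t = y t) \<Longrightarrow> x = y"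
  unfolding paths_in_def by (auto intro: extensionalityI)

lemma compose_in_paths_in:
  assumes "x \<in> paths_in Y" "continuous_on {0..1} \<phi>" "\<phi> ` {0..1} \<subseteq> {0..1}"
  shows "compose {0..1} x \<phi> \<in> paths_in Y"
proof -
  have "continuous_map (top_of_set {0..1}) Y (x \<circ> \<phi>)"
    by (rule continuous_map_compose[of _ "top_of_set {0..1}"])
      (use assms in \<open>auto simp: paths_in_def pathin_def continuous_map_in_subtopology\<close>)
  then have "continuous_map (top_of_set {0..1}) Y (compose {0..1} x \<phi>)"
    by (rule continuous_map_eq) (simp add: compose_def)
  then show ?thesis by (simp add: paths_in_def pathin_def)
qed

lemma compose_image: "K \<subseteq> A \<Longrightarrow> compose A x \<phi> ` K = x ` \<phi> ` K"
  unfolding compose_def image_image by (intro image_cong) auto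

lemma continuous_map_precompose:
  assumes "continuous_on {0..1} \<phi>" "\<phi> ` {0..1} \<subseteq> {0..1}"
  shows "continuous_map (compact_open_topology Y) (compact_open_topology Y) (\<lambda>x. compose {0..1} x \<phi>)"
proof (rule continuous_map_into_compact_open)
  show "(\<lambda>x. compose {0..1} x \<phi>) ` topspace (compact_open_topology Y) \<subseteq> paths_in Y"
    using compose_in_paths_in[OF _ assms] by (auto simp: topspace_compact_open)
  fix K U assume KU: "compact K" "K \<subseteq> {0..1::real}" "openin Y U"
  have "openin (compact_open_topology Y) {x \<in> paths_in Y. x ` (\<phi> ` K) \<subseteq> U}"
    by (rule openin_compact_open_subbasic)
      (use KU assms in \<open>auto intro!: compact_continuous_image intro: continuous_on_subset\<close>)
  then show "openin (compact_open_topology Y)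
      {x \<in> topspace (compact_open_topology Y). compose {0..1} x \<phi> ` K \<subseteq> U}"
    by (simp add: compose_image[OF KU(2)] topspace_compact_open)
qed

text \<open>The compact set \<open>C\<close> serves as the buffer when path and parameter vary
  together: parameters close to \<open>K\<close> stay in \<open>C\<close>, while sending
  \<open>C\<close> into \<open>U\<close> is an open condition on the path.\<close>

lemma path_compact_thickening:
  assumes x: "x \<in> paths_in Y" and U: "openin Y U" and K: "compact K" "K \<subseteq> {0..1}" and xK: "x ` K \<subseteq> U"
  obtains C \<epsilon> where "compact C" "C \<subseteq> {0..1}" "x ` C \<subseteq> U" "\<epsilon> > 0"
    "\<And>s s'. s \<in> K \<Longrightarrow> s' \<in> {0..1} \<Longrightarrow> \<bar>s' - s\<bar> \<le> \<epsilon> \<Longrightarrow> s' \<in> C"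
proof -
  have "openin (top_of_set {0..1}) {t \<in> topspace (top_of_set {0..1}). x t \<in> U}"
    by (rule openin_continuous_map_preimage[OF _ U]) (use x in \<open>simp add: paths_in_def pathin_def\<close>)
  then obtain W where W: "open W" "{t \<in> {0..1}. x t \<in> U} = {0..1} \<inter> W"
    by (auto simp: openin_open)
  have "K \<subseteq> W" using W(2) K(2) xK by blast
  then obtain e where e: "e > 0" "(\<Union>r\<in>K. ball r e) \<subseteq> W"
    using compact_subset_open_imp_ball_epsilon_subset[OF K(1) W(1)] by blast
  \<comment> \<open>The closed neighbourhood of half the radius is compact, as a sum of compact
    sets, and still lies in \<open>W\<close>.\<close>
  define C where "C = {0..1} \<inter> {a + b | a b. a \<in> K \<and> b \<in> cball (0::real) (e/2)}"
  have "compact {a + b | a b. a \<in> K \<and> b \<in> cball (0::real) (e/2)}"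
    by (rule compact_sums[OF K(1) compact_cball])
  then have "compact C" unfolding C_def by (intro closed_Int_compact closed_atLeastAtMost)
  moreover have "C \<subseteq> {0..1}" by (simp add: C_def)
  moreover have "x ` C \<subseteq> U"
  proof
    fix p assume "p \<in> x ` C"
    then obtain a b where ab: "a \<in> K" "\<bar>b\<bar> \<le> e/2" "a + b \<in> {0..1}" "p = x (a + b)" by (auto simp: C_def)
    then have "a + b \<in> ball a e" using e(1) by (simp add: dist_real_def)
    then have "a + b \<in> W" using e(2) ab(1) by blast
    then show "p \<in> U" using W(2) ab(3,4) by blast
  qed
  moreover have "s' \<in> C" if "s \<in> K" "s' \<in> {0..1}" "\<bar>s' - s\<bar> \<le> e/2" for s s'
  proof -
    have "s' - s \<in> cball 0 (e/2)" using that(3) by simp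
    then have "s + (s' - s) \<in> {a + b | a b. a \<in> K \<and> b \<in> cball (0::real) (e/2)}" using that(1) by blast
    then show ?thesis using that(2) by (simp add: C_def)
  qed
  ultimately show ?thesis using that[of C "e/2"] e(1) by simp
qed

text \<open>This is continuity of composition in the parameter for a fixed path, with the uniform
  distance on parameters. Thickening treats subbasic sets, and induction over the generated topology
  treats the rest.\<close>

lemma compose_near:
  assumes x: "x \<in> paths_in Y" and V: "openin (compact_open_topology Y) V"
    and "continuous_on {0..1} \<phi>" "\<phi> ` {0..1} \<subseteq> {0..1}" "compose {0..1} x \<phi> \<in> V"
  shows "\<exists>e>0. \<forall>\<psi>. continuous_on {0..1} \<psi> \<and> \<psi> ` {0..1} \<subseteq> {0..1} \<and>
      (\<forall>t\<in>{0..1}. \<bar>\<psi> t - \<phi> t\<bar> < e) \<longrightarrow> compose {0..1} x \<psi> \<in> V"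
proof -
  let ?S = "{{x \<in> paths_in Y. x ` K \<subseteq> U} | K U. compact K \<and> K \<subseteq> {0..1} \<and> openin Y U}"
  have "generate_topology_on ?S V"
    using V unfolding compact_open_topology_def by (simp add: openin_topology_generated_by_iff)
  then show ?thesis using assms(5)
  proof (induction rule: generate_topology_on.induct)
    case (Int a b)
    then obtain e1 e2 where "e1 > 0" "e2 > 0"
      and e1: "\<forall>\<psi>. continuous_on {0..1} \<psi> \<and> \<psi> ` {0..1} \<subseteq> {0..1} \<and>
      (\<forall>t\<in>{0..1}. \<bar>\<psi> t - \<phi> t\<bar> < e1) \<longrightarrow> compose {0..1} x \<psi> \<in> a"
      and e2: "\<forall>\<psi>. continuous_on {0..1} \<psi> \<and> \<psi> ` {0..1} \<subseteq> {0..1} \<and>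
      (\<forall>t\<in>{0..1}. \<bar>\<psi> t - \<phi> t\<bar> < e2) \<longrightarrow> compose {0..1} x \<psi> \<in> b"
      by auto
    then show ?case by (intro exI[of _ "min e1 e2"]) auto
  next
    case (UN K)
    then obtain k where k: "k \<in> K" "compose {0..1} x \<phi> \<in> k" by blast
    from UN(2)[OF this] k(1) show ?case by blast
  next
    case (Basis s)
    then obtain K U where KU: "compact K" "K \<subseteq> {0..1}" "openin Y U" and s: "s = {x \<in> paths_in Y. x ` K \<subseteq> U}"
      by blast
    have K0: "compact (\<phi> ` K)" "\<phi> ` K \<subseteq> {0..1}" "x ` \<phi> ` K \<subseteq> U"
      using KU assms(3,4) Basis(2) 
      by (auto simp: s compose_image intro!: compact_continuous_image intro: continuous_on_subset)
    obtain C e where "x ` C \<subseteq> U" "e > 0"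
      and C: "\<And>s s'. s \<in> \<phi> ` K \<Longrightarrow> s' \<in> {0..1} \<Longrightarrow> \<bar>s' - s\<bar> \<le> e \<Longrightarrow> s' \<in> C"
      by (rule path_compact_thickening[OF x KU(3) K0]) blast
    show ?case
    proof (intro exI[of _ e] conjI allI impI)
      fix \<psi> assume \<psi>: "continuous_on {0..1} \<psi> \<and> \<psi> ` {0..1} \<subseteq> {0..1} \<and> (\<forall>t\<in>{0..1}. \<bar>\<psi> t - \<phi> t\<bar> < e)"
      have "\<psi> ` K \<subseteq> C"
      proof
        fix s' assume "s' \<in> \<psi> ` K"
        then obtain t where t: "t \<in> K" "s' = \<psi> t" by blast
        then have "t \<in> {0..1}" using KU(2) by blast
        then have "\<psi> t \<in> {0..1}" "\<bar>\<psi> t - \<phi> t\<bar> < e" using \<psi> by blast+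
        then show "s' \<in> C" using C[of "\<phi> t" s'] t by auto
      qed
      then have "x ` \<psi> ` K \<subseteq> U" using \<open>x ` C \<subseteq> U\<close> by blast
      then show "compose {0..1} x \<psi> \<in> s"
        using compose_in_paths_in[OF x] \<psi> KU(2) by (simp add: s compose_image)
    qed (use \<open>e > 0\<close> in auto)
  qed auto
qed

section \<open>The monoid of reparametrizations\<close>

lemma Rep_plusD:
  assumes "\<phi> \<in> Rep_plus"
  shows "continuous_on {0..1} \<phi>" "mono_on {0..1} \<phi>" "\<phi> ` {0..1} = {0..1}" "\<phi> 0 = 0" "\<phi> 1 = 1"
proof -
  show 1: "continuous_on {0..1} \<phi>" "mono_on {0..1} \<phi>" "\<phi> ` {0..1} = {0..1}"
    using assms by (auto simp: Rep_plus_def)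
  obtain s where s: "s \<in> {0..1}" "\<phi> s = 0" using 1(3) by (metis atLeastAtMost_iff imageE order_refl zero_le_one)
  obtain t where t: "t \<in> {0..1}" "\<phi> t = 1" using 1(3) by (metis atLeastAtMost_iff imageE order_refl zero_le_one)
  have "\<phi> 0 \<in> {0..1}" "\<phi> 1 \<in> {0..1}" using 1(3) by fastforce+
  then show "\<phi> 0 = 0" "\<phi> 1 = 1"
    using mono_onD[OF 1(2), of 0 s] mono_onD[OF 1(2), of t 1] s t by auto
qed

lemma Rep_plusI:
  assumes "continuous_on {0..1} \<phi>" "mono_on {0..1} \<phi>" "\<phi> 0 = 0" "\<phi> 1 = 1"
  shows "restrict \<phi> {0..1} \<in> Rep_plus"
proof -
  have "\<phi> t \<in> {0..1}" if "t \<in> {0..1}" for t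
    using mono_onD[OF assms(2), of 0 t] mono_onD[OF assms(2), of t 1] that assms by auto
  moreover have "r \<in> \<phi> ` {0..1}" if "r \<in> {0..1}" for r
    using IVT'[of \<phi> 0 r 1] that assms by force
  ultimately have "\<phi> ` {0..1} = {0..1}" by blast
  then show ?thesis
    using assms continuous_on_cong[of "{0..1}" "{0..1}" "restrict \<phi> {0..1}" \<phi>]
    by (auto simp: Rep_plus_def mono_on_def)
qed

lemma Rep_plus_compose:
  assumes "\<phi> \<in> Rep_plus" "\<psi> \<in> Rep_plus"
  shows "compose {0..1} \<phi> \<psi> \<in> Rep_plus"
proof -
  have "restrict (\<phi> \<circ> \<psi>) {0..1} \<in> Rep_plus"
  proof (rule Rep_plusI)
    show "continuous_on {0..1} (\<phi> \<circ> \<psi>)"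
      using Rep_plusD[OF assms(1)] Rep_plusD[OF assms(2)] by (intro continuous_on_compose) auto
    show "mono_on {0..1} (\<phi> \<circ> \<psi>)"
    proof (rule mono_onI)
      fix r s :: real assume rs: "r \<in> {0..1}" "s \<in> {0..1}" "r \<le> s"
      then have "\<psi> r \<in> {0..1}" "\<psi> s \<in> {0..1}" using Rep_plusD(3)[OF assms(2)] by blast+
      then show "(\<phi> \<circ> \<psi>) r \<le> (\<phi> \<circ> \<psi>) s"
        using mono_onD[OF Rep_plusD(2)[OF assms(1)]] mono_onD[OF Rep_plusD(2)[OF assms(2)] rs] by simp
    qed
  qed (use Rep_plusD[OF assms(1)] Rep_plusD[OF assms(2)] in auto)
  then show ?thesis by (simp add: compose_def comp_def)
qed

lemma Rep_plus_id: "restrict (\<lambda>t. t) {0..1} \<in> Rep_plus"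
  by (rule Rep_plusI) (auto simp: mono_on_def)

lemma compose_compose:
  "\<psi> ` A \<subseteq> A \<Longrightarrow> compose A (compose A x \<phi>) \<psi> = compose A x (compose A \<phi> \<psi>)"
  by (auto simp: compose_def fun_eq_iff)

text \<open>Plateaus of \<phi> prevent a continuous right inverse. Mixing in the identity with
  weight \<open>d\<close> gives a strictly increasing \<open>f\<close>, whose inverse \<rho> misses
  the target by \<open>d\<close> times the distance of \<open>\<phi> (\<rho> t)\<close> and
  \<open>\<rho> t\<close>, hence by at most \<open>d < e\<close>.\<close>

lemma Rep_plus_approximate_right_inverse:
  assumes \<phi>: "\<phi> \<in> Rep_plus" and e: "e > 0"
  shows "\<exists>\<rho>\<in>Rep_plus. \<forall>t\<in>{0..1}. \<bar>\<phi> (\<rho> t) - t\<bar> < e"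
proof -
  define d where "d = min (1/2) (e/2)"
  have d: "0 < d" "d < 1" "d < e" using e by (auto simp: d_def)
  define f where "f t = (1 - d) * \<phi> t + d * t" for t
  note \<phi>D = Rep_plusD[OF \<phi>]
  have strict: "f s < f t" if "s \<in> {0..1}" "t \<in> {0..1}" "s < t" for s t
    unfolding f_def using that d mono_onD[OF \<phi>D(2) that(1,2)]
    by (intro add_le_less_mono mult_left_mono mult_strict_left_mono) auto
  have inj: "inj_on f {0..1}"
    by (rule linorder_inj_onI) (use strict in force)+
  have contf: "continuous_on {0..1} f"
    unfolding f_def by (intro continuous_intros \<phi>D)
  have mono: "mono_on {0..1} f" using strict by (intro mono_onI) (metis order_le_less)
  have "restrict f {0..1} \<in> Rep_plus" 
    by (rule Rep_plusI[OF contf mono]) (use \<phi>D in \<open>auto simp: f_def\<close>)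
  from Rep_plusD(3)[OF this] have surj: "f ` {0..1} = {0..1}" by simp
  define \<rho> where "\<rho> = the_inv_into {0..1} f"
  have \<rho>: "\<rho> t \<in> {0..1}" "f (\<rho> t) = t" if "t \<in> {0..1}" for t
    using the_inv_into_into[OF inj, of t "{0..1}"] f_the_inv_into_f[OF inj, of t] that surj
    unfolding \<rho>_def by auto
  have \<rho>f: "\<rho> (f t) = t" if "t \<in> {0..1}" for t
    unfolding \<rho>_def by (rule the_inv_into_f_f[OF inj that])
  have "restrict \<rho> {0..1} \<in> Rep_plus"
  proof (rule Rep_plusI)
    show "continuous_on {0..1} \<rho>"
      using continuous_on_inv_into[OF contf compact_Icc inj] surj by (simp add: \<rho>_def)
    show "mono_on {0..1} \<rho>"
    proof (rule mono_onI, rule ccontr)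
      fix r s :: real assume rs: "r \<in> {0..1}" "s \<in> {0..1}" "r \<le> s" "\<not> \<rho> r \<le> \<rho> s"
      then have "f (\<rho> s) < f (\<rho> r)" by (intro strict \<rho>) auto
      then show False using rs \<rho> by simp
    qed
    have "f 0 = 0" "f 1 = 1" using \<phi>D by (auto simp: f_def)
    then show "\<rho> 0 = 0" "\<rho> 1 = 1" using \<rho>f[of 0] \<rho>f[of 1] by auto
  qed
  moreover have "\<bar>\<phi> (\<rho> t) - t\<bar> < e" if "t \<in> {0..1}" for t
  proof -
    have "\<phi> (\<rho> t) - t = \<phi> (\<rho> t) - f (\<rho> t)" using \<rho>(2)[OF that] by simp
    also have "\<dots> = d * (\<phi> (\<rho> t) - \<rho> t)" by (simp add: f_def algebra_simps)
    finally have "\<bar>\<phi> (\<rho> t) - t\<bar> = d * \<bar>\<phi> (\<rho> t) - \<rho> t\<bar>" using d by (simp add: abs_mult)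
    also have "\<dots> \<le> d * 1"
    proof -
      have "\<phi> (\<rho> t) \<in> {0..1}" using \<phi>D(3) \<rho>(1)[OF that] by blast
      then show ?thesis using \<rho>(1)[OF that] d by (intro mult_left_mono) auto
    qed
    finally show ?thesis using d by simp
  qed
  ultimately show ?thesis by (intro bexI[of _ "restrict \<rho> {0..1}"]) auto
qed

section \<open>Metrization of compact second countable Hausdorff spaces\<close>

text \<open>Urysohn's argument: compactness gives normality, and each of the countably many pairs of
  basic sets with disjoint closures contributes one coordinate. Distinct points are separated by
  such a pair.\<close>

lemma compact_Hausdorff_second_countable_embedding:
  assumes comp: "compact_space Z" and haus: "Hausdorff_space Z" and sc: "second_countable Z"
  shows "\<exists>e :: 'a \<Rightarrow> nat \<Rightarrow> real. continuous_map Z euclidean e \<and> inj_on e (topspace Z)"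
proof -
  have normal: "normal_space Z" using comp haus by (simp add: compact_Hausdorff_or_regular_imp_normal_space)
  obtain \<B> where \<B>: "countable \<B>" "\<And>V. V \<in> \<B> \<Longrightarrow> openin Z V"
    "\<And>U x. openin Z U \<Longrightarrow> x \<in> U \<Longrightarrow> \<exists>V\<in>\<B>. x \<in> V \<and> V \<subseteq> U"
    using sc unfolding second_countable_def by metis
  define good where "good = {(A, B). A \<in> \<B> \<and> B \<in> \<B> \<and> Z closure_of A \<inter> Z closure_of B = {}}"
  have "countable good"
    by (rule countable_subset[of _ "\<B> \<times> \<B>"]) (use \<B>(1) in \<open>auto simp: good_def\<close>)
  have "\<forall>p\<in>good. \<exists>f :: 'a \<Rightarrow> real. continuous_map Z euclideanreal f \<and>
      f ` (Z closure_of fst p) \<subseteq> {0} \<and> f ` (Z closure_of snd p) \<subseteq> {1}"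
  proof
    fix p assume "p \<in> good"
    then have "disjnt (Z closure_of fst p) (Z closure_of snd p)" by (auto simp: good_def disjnt_def)
    then show "\<exists>f :: 'a \<Rightarrow> real. continuous_map Z euclideanreal f \<and>
      f ` (Z closure_of fst p) \<subseteq> {0} \<and> f ` (Z closure_of snd p) \<subseteq> {1}"
      by (rule Urysohn_lemma_alt[OF normal closedin_closure_of closedin_closure_of, of _ _ 0 1]) blast
  qed
  from bchoice[OF this] obtain f where f: "\<forall>p\<in>good. continuous_map Z euclideanreal (f p) \<and>
      f p ` (Z closure_of fst p) \<subseteq> {0} \<and> f p ` (Z closure_of snd p) \<subseteq> {1}" ..
  \<comment> \<open>Without good pairs there is nothing to enumerate, and a constant map serves;
    injectivity survives because two distinct points would produce a good pair.\<close>
  define e where "e z n = (if good = {} then 0 else f (from_nat_into good n) z)" for z n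
  have "continuous_map Z euclideanreal (\<lambda>z. e z n)" for n
    using f from_nat_into[of good n] by (cases "good = {}") (auto simp: e_def)
  then have "continuous_map Z euclidean e"
    by (simp flip: euclidean_product_topology add: continuous_map_componentwise_UNIV)
  moreover have "inj_on e (topspace Z)"
  proof (rule inj_onI, rule ccontr)
    fix p q assume pq: "p \<in> topspace Z" "q \<in> topspace Z" "e p = e q" "p \<noteq> q"
    have "closedin Z {p}" "closedin Z {q}"
      using pq closedin_t1_singleton[OF Hausdorff_imp_t1_space[OF haus]] by auto
    then obtain U V where UV: "openin Z U" "openin Z V" "{p} \<subseteq> U" "{q} \<subseteq> V"
      "disjnt (Z closure_of U) (Z closure_of V)"
      using normal_space_disjoint_closures[THEN iffD1, OF normal, rule_format, of "{p}" "{q}"] pq(4)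
      by (auto simp: disjnt_def)
    obtain A B where AB: "A \<in> \<B>" "p \<in> A" "A \<subseteq> U" "B \<in> \<B>" "q \<in> B" "B \<subseteq> V"
      using \<B>(3)[OF UV(1)] \<B>(3)[OF UV(2)] UV(3,4) by (metis insert_subset)
    have g: "(A, B) \<in> good"
      using AB UV(5) closure_of_mono[OF AB(3), of Z] closure_of_mono[OF AB(6), of Z]
      by (auto simp: good_def disjnt_def)
    then obtain n where n: "from_nat_into good n = (A, B)"
      using from_nat_into_surj[OF \<open>countable good\<close>] by blast
    have "p \<in> Z closure_of A" "q \<in> Z closure_of B"
      using closure_of_subset[of A Z] closure_of_subset[of B Z] AB openin_subset[OF UV(1)] openin_subset[OF UV(2)]
      by blast+
    then have "e p n = 0" "e q n = 1" using bspec[OF f g] g n by (auto simp: e_def image_subset_iff)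
    then show False using pq(3) by simp
  qed
  ultimately show ?thesis by blast
qed

section \<open>Traces\<close>

lemma topspace_k_Delta [simp]: "topspace (k_Delta Y) = topspace Y"
  unfolding k_Delta_def by (rule topspace_final_topology) (auto simp: continuous_map_def)

lemma openin_k_Delta:
  "openin (k_Delta Y) U \<longleftrightarrow> U \<subseteq> topspace Y \<and>
    (\<forall>n f. continuous_map (simplex_space n) Y f \<longrightarrow>
      openin (simplex_space n) {z \<in> topspace (simplex_space n). f z \<in> U})"
  unfolding k_Delta_def openin_final_topology by blast

lemma openin_imp_openin_k_Delta: "openin Y U \<Longrightarrow> openin (k_Delta Y) U"
  unfolding openin_k_Delta by (intro conjI allI impI openin_subset openin_continuous_map_preimage)

lemma continuous_map_k_Delta_imp: 
  assumes "continuous_map Z (k_Delta Y) f" shows "continuous_map Z Y f"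
  using assms openin_imp_openin_k_Delta unfolding continuous_map_def by auto

text \<open>Openness in \<open>k_Delta Y\<close> is tested on all simplices of \<open>Y\<close>, in
  particular on \<open>f\<close> itself. Hence \<open>k_Delta\<close> is idempotent.\<close>

lemma continuous_map_simplex_k_Delta:
  "continuous_map (simplex_space n) (k_Delta Y) f \<longleftrightarrow> continuous_map (simplex_space n) Y f"
  (is "?L \<longleftrightarrow> ?R")
proof
  assume ?R
  then show ?L unfolding continuous_map_def[of _ "k_Delta Y"] openin_k_Delta
    by (auto simp: continuous_map_def Pi_iff)
qed (rule continuous_map_k_Delta_imp)

lemma Delta_generated_k_Delta: "Delta_generated (k_Delta Y)"
  unfolding Delta_generated_def topology_eq
  by (simp only: openin_k_Delta[of "k_Delta Y"] continuous_map_simplex_k_Delta openin_k_Delta[of Y] topspace_k_Delta simp_thms)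

text \<open>A simplex of \<open>Z\<close> followed by \<open>q\<close> is a simplex of the quotient,
  so a set that passes all simplex tests in the quotient has a preimage that passes them in
  \<open>Z\<close>.\<close>

lemma Delta_generated_final_topology:
  assumes Z: "Delta_generated Z" and q: "q ` topspace Z \<subseteq> S"
  shows "Delta_generated (final_topology S {(Z, q)})"
proof -
  let ?T = "final_topology S {(Z, q)}"
  have top: "topspace ?T = S" by (rule topspace_final_topology) (use q in auto)
  have cont: "continuous_map Z ?T q"
    unfolding continuous_map_def top by (use q in \<open>auto simp: openin_final_topology\<close>)
  have "openin ?T U" if U: "openin (k_Delta ?T) U" for U
  proof -
    have "openin (k_Delta Z) {z \<in> topspace Z. q z \<in> U}"
      unfolding openin_k_Delta
    proof (intro conjI allI impI)
      fix n f assume f: "continuous_map (simplex_space n) Z f"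
      have "continuous_map (simplex_space n) ?T (q \<circ> f)"
        by (rule continuous_map_compose[OF f cont])
      then have "openin (simplex_space n) {z \<in> topspace (simplex_space n). (q \<circ> f) z \<in> U}"
        using U unfolding openin_k_Delta by blast
      moreover have "f z \<in> topspace Z" if "z \<in> topspace (simplex_space n)" for z
        using f that by (auto simp: continuous_map_def)
      ultimately show "openin (simplex_space n)
          {z \<in> topspace (simplex_space n). f z \<in> {z \<in> topspace Z. q z \<in> U}}"
        by (smt (verit) Collect_cong comp_apply mem_Collect_eq)
    qed auto
    then have "openin Z {z \<in> topspace Z. q z \<in> U}" using Z by (simp add: Delta_generated_def)
    moreover have "U \<subseteq> S" using openin_subset[OF U] top by simp
    ultimately show ?thesis by (auto simp: openin_final_topology)
  qed
  then show ?thesis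
    unfolding Delta_generated_def topology_eq using openin_imp_openin_k_Delta by blast
qed

section \<open>Trace equivalence and openness of the quotient map\<close>

locale saturated_dspace =
  fixes c :: top_category and X :: "'a dspace"
  assumes directed: "directed_space c X" and saturated: "saturated X"
    and Hausdorff: "Hausdorff_space (uspace X)" and second_countable: "second_countable (uspace X)"
begin

abbreviation CO :: "(real \<Rightarrow> 'a) topology" where "CO \<equiv> compact_open_topology (uspace X)"

lemma dpaths_subset: "dpaths X \<subseteq> paths_in (uspace X)"
  using directed by (simp add: directed_space_def)

lemma dpaths_between_subset: "dpaths_between X u v \<subseteq> paths_in (uspace X)"
  using dpaths_subset by (auto simp: dpaths_between_def)

text \<open>The direction from the composite back to \<open>x\<close> is saturation; the other one
  is an axiom of directed spaces.\<close>

lemma compose_Rep_plus_in_dpaths_iff: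
  assumes x: "x \<in> paths_in (uspace X)" and \<phi>: "\<phi> \<in> Rep_plus"
  shows "compose {0..1} x \<phi> \<in> dpaths X \<longleftrightarrow> x \<in> dpaths X"
proof
  assume "x \<in> dpaths X"
  moreover have "continuous_on {0..1} \<phi> \<and> mono_on {0..1} \<phi> \<and> \<phi> ` {0..1} \<subseteq> {0..1}"
    using Rep_plusD[OF \<phi>] by simp
  ultimately show "compose {0..1} x \<phi> \<in> dpaths X"
    using directed unfolding directed_space_def by blast
qed (use saturated x \<phi> in \<open>auto simp: saturated_def\<close>)

lemma compose_Rep_plus_in_dpaths_between_iff:
  assumes x: "x \<in> paths_in (uspace X)" and \<phi>: "\<phi> \<in> Rep_plus"
  shows "compose {0..1} x \<phi> \<in> dpaths_between X u v \<longleftrightarrow> x \<in> dpaths_between X u v"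
  unfolding dpaths_between_def
  using compose_Rep_plus_in_dpaths_iff[OF assms] Rep_plusD(4,5)[OF \<phi>] by (simp add: compose_def)

lemma trace_equivalent_step:
  assumes "x \<in> dpaths X" "\<phi> \<in> Rep_plus"
  shows "trace_equivalent X x (compose {0..1} x \<phi>)"
  unfolding trace_equivalent_def by (rule r_into_equivclp) (use assms in blast)

lemma trace_equivalent_refl: "trace_equivalent X x x"
  unfolding trace_equivalent_def by simp

lemma trace_equivalent_sym: "trace_equivalent X x y \<Longrightarrow> trace_equivalent X y x"
  unfolding trace_equivalent_def by (rule equivclp_sym)

lemma trace_equivalent_trans:
  "trace_equivalent X x y \<Longrightarrow> trace_equivalent X y z \<Longrightarrow> trace_equivalent X x z"
  unfolding trace_equivalent_def by (rule equivclp_trans)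

text \<open>Equivalence is a zigzag of reparametrizations, so an invariant has to be checked on a
  single one only. With a truth value as \<open>f\<close> this also propagates properties along
  traces.\<close>

lemma trace_equivalent_invariant:
  assumes "trace_equivalent X x y" 
    and "\<And>z \<phi>. z \<in> dpaths X \<Longrightarrow> \<phi> \<in> Rep_plus \<Longrightarrow> f (compose {0..1} z \<phi>) = f z"
  shows "f x = f y"
  using assms(1) unfolding trace_equivalent_def
proof (induction rule: equivclp_induct)
  case (step y z)
  then show ?case using assms(2) by metis
qed simp

lemma trace_equivalent_image:
  assumes "trace_equivalent X x y" shows "x ` {0..1} = y ` {0..1}"
  using assms by (rule trace_equivalent_invariant) (simp add: compose_image Rep_plusD(3))

lemma trace_of_eq_iff:
  assumes "x \<in> dpaths_between X u v" "y \<in> dpaths_between X u v"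
  shows "trace_of X u v x = trace_of X u v y \<longleftrightarrow> trace_equivalent X x y"
proof
  assume "trace_of X u v x = trace_of X u v y"
  moreover have "y \<in> trace_of X u v y" using assms by (simp add: trace_of_def trace_equivalent_refl)
  ultimately have "y \<in> trace_of X u v x" by simp
  then show "trace_equivalent X x y" by (simp add: trace_of_def)
next
  assume "trace_equivalent X x y"
  then show "trace_of X u v x = trace_of X u v y"
    unfolding trace_of_def by (metis trace_equivalent_sym trace_equivalent_trans)
qed

lemma mem_trace_of: "x \<in> dpaths_between X u v \<Longrightarrow> x \<in> trace_of X u v x"
  by (simp add: trace_of_def trace_equivalent_refl)

lemma topspace_dpath_space [simp]: "topspace (dpath_space X u v) = dpaths_between X u v"
  using dpaths_between_subset by (auto simp: dpath_space_def topspace_compact_open)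

lemma topspace_trace_space [simp]: "topspace (trace_space X u v) = trace_of X u v ` dpaths_between X u v"
  unfolding trace_space_def by (rule topspace_final_topology) auto

lemma openin_trace_space:
  "openin (trace_space X u v) W \<longleftrightarrow> W \<subseteq> trace_of X u v ` dpaths_between X u v \<and>
    openin (dpath_space X u v) {x \<in> dpaths_between X u v. trace_of X u v x \<in> W}"
  unfolding trace_space_def openin_final_topology by simp

lemma continuous_map_trace_of: "continuous_map (dpath_space X u v) (trace_space X u v) (trace_of X u v)"
  unfolding continuous_map_def by (auto simp: openin_trace_space)

lemma closedin_trace_space_iff:
  assumes "W \<subseteq> topspace (trace_space X u v)"
  shows "closedin (trace_space X u v) W \<longleftrightarrow>
    closedin (dpath_space X u v) {x \<in> dpaths_between X u v. trace_of X u v x \<in> W}"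
proof -
  have "dpaths_between X u v - {x \<in> dpaths_between X u v. trace_of X u v x \<in> W} =
     {x \<in> dpaths_between X u v. trace_of X u v x \<in> trace_of X u v ` dpaths_between X u v - W}" by auto
  then show ?thesis using assms by (auto simp: closedin_def openin_trace_space)
qed

lemma openin_dpath_space: "openin CO V \<Longrightarrow> openin (dpath_space X u v) (V \<inter> dpaths_between X u v)"
  unfolding dpath_space_def by (intro openin_imp_openin_k_Delta openin_subtopology_Int)

text \<open>The quotient map is open for the compact-open topology: a path equivalent to some \<open>x \<in> V\<close> has a
  reparametrization in \<open>V\<close> because every \<open>\<phi>\<close> has approximate right inverses.\<close>

lemma trace_equivalent_reparametrization_in:
  assumes V: "openin CO V" and "trace_equivalent X x y" "x \<in> dpaths X" "x \<in> V"
  shows "\<exists>\<kappa>\<in>Rep_plus. compose {0..1} y \<kappa> \<in> V"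
proof -
  \<comment> \<open>The zigzag may run against a reparametrization, so the property has to pass in
    both directions; only the passage from \<open>z\<close> to its reparametrization needs
    approximate inverses.\<close>
  define P where "P y \<longleftrightarrow> (\<exists>\<kappa>\<in>Rep_plus. compose {0..1} y \<kappa> \<in> V)" for y
  have "P x = P y"
    using assms(2)
  proof (rule trace_equivalent_invariant)
    fix z \<phi> assume z: "z \<in> dpaths X" and \<phi>: "\<phi> \<in> Rep_plus"
    then have zp: "z \<in> paths_in (uspace X)" using dpaths_subset by blast
    show "P (compose {0..1} z \<phi>) = P z"
    proof
      assume "P (compose {0..1} z \<phi>)"
      then show "P z"
        unfolding P_def using Rep_plus_compose[OF \<phi>] by (metis compose_compose Rep_plusD(3) order_refl)
    next
      assume "P z"
      then obtain \<kappa> where \<kappa>: "\<kappa> \<in> Rep_plus" "compose {0..1} z \<kappa> \<in> V" unfolding P_def by blast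
      obtain e where e: "e > 0" "\<And>\<psi>. continuous_on {0..1} \<psi> \<Longrightarrow> \<psi> ` {0..1} \<subseteq> {0..1} \<Longrightarrow>
          \<forall>t\<in>{0..1}. \<bar>\<psi> t - \<kappa> t\<bar> < e \<Longrightarrow> compose {0..1} z \<psi> \<in> V"
        using compose_near[OF zp V Rep_plusD(1)[OF \<kappa>(1)] _ \<kappa>(2)] Rep_plusD(3)[OF \<kappa>(1)] by auto
      obtain \<rho> where \<rho>: "\<rho> \<in> Rep_plus" "\<forall>t\<in>{0..1}. \<bar>\<phi> (\<rho> t) - t\<bar> < e"
        using Rep_plus_approximate_right_inverse[OF \<phi> e(1)] by blast
      \<comment> \<open>Then \<phi> after \<sigma> equals \<phi> after \<rho> after \<kappa>, which
        is uniformly \<open>e\<close>-close to \<kappa>.\<close>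
      define \<sigma> where "\<sigma> = compose {0..1} \<rho> \<kappa>"
      have \<sigma>: "\<sigma> \<in> Rep_plus" unfolding \<sigma>_def by (rule Rep_plus_compose[OF \<rho>(1) \<kappa>(1)])
      have *: "compose {0..1} \<phi> \<sigma> \<in> Rep_plus" by (rule Rep_plus_compose[OF \<phi> \<sigma>])
      have "compose {0..1} z (compose {0..1} \<phi> \<sigma>) \<in> V"
      proof (rule e(2))
        show "\<forall>t\<in>{0..1}. \<bar>compose {0..1} \<phi> \<sigma> t - \<kappa> t\<bar> < e"
        proof
          fix t :: real assume t: "t \<in> {0..1}"
          then have "\<kappa> t \<in> {0..1}" using Rep_plusD(3)[OF \<kappa>(1)] by blast
          then show "\<bar>compose {0..1} \<phi> \<sigma> t - \<kappa> t\<bar> < e"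
            using \<rho>(2) t by (simp add: compose_def \<sigma>_def)
        qed
      qed (use Rep_plusD[OF *] in auto)
      then show "P (compose {0..1} z \<phi>)"
        unfolding P_def using \<sigma> Rep_plusD(3)[OF \<sigma>] by (metis compose_compose order_refl)
    qed
  qed
  moreover have "P x"
  proof -
    have "x \<in> extensional {0..1}" using assms(3) dpaths_subset by (auto simp: paths_in_def)
    then have "compose {0..1} x (restrict (\<lambda>t. t) {0..1}) = x"
      by (intro extensionalityI[of _ "{0..1}"]) (auto simp: compose_def)
    then show ?thesis unfolding P_def using Rep_plus_id assms(4) by metis
  qed
  ultimately show ?thesis unfolding P_def by simp
qed

text \<open>The saturation of \<open>V\<close> is the union over all \<kappa> of the preimages of
  \<open>V\<close> under precomposition with \<kappa>, and each of these is already open in the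
  compact-open topology.\<close>

lemma openin_trace_space_image:
  assumes V: "openin CO V"
  shows "openin (trace_space X u v) (trace_of X u v ` (V \<inter> dpaths_between X u v))"
  unfolding openin_trace_space
proof
  let ?D = "dpaths_between X u v"
  let ?pre = "\<lambda>\<kappa>. {x \<in> paths_in (uspace X). compose {0..1} x \<kappa> \<in> V}"
  have "{x \<in> ?D. trace_of X u v x \<in> trace_of X u v ` (V \<inter> ?D)} = (\<Union>\<kappa>\<in>Rep_plus. ?pre \<kappa>) \<inter> ?D" (is "?A = ?B")
  proof (intro equalityI subsetI)
    fix y assume "y \<in> ?A"
    then obtain x where "y \<in> ?D" "x \<in> V" "x \<in> ?D" "trace_of X u v y = trace_of X u v x" by blast
    then have "\<exists>\<kappa>\<in>Rep_plus. compose {0..1} y \<kappa> \<in> V"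
      using trace_of_eq_iff trace_equivalent_sym
      by (intro trace_equivalent_reparametrization_in[OF V, of x]) (auto simp: dpaths_between_def)
    then show "y \<in> ?B" using \<open>y \<in> ?D\<close> dpaths_between_subset by blast
  next
    fix y assume "y \<in> ?B"
    then obtain \<kappa> where \<kappa>: "\<kappa> \<in> Rep_plus" "compose {0..1} y \<kappa> \<in> V" and y: "y \<in> ?D" by blast
    then have "compose {0..1} y \<kappa> \<in> ?D"
      using compose_Rep_plus_in_dpaths_between_iff dpaths_between_subset by blast
    moreover have "trace_equivalent X y (compose {0..1} y \<kappa>)"
      by (rule trace_equivalent_step) (use y \<kappa> in \<open>auto simp: dpaths_between_def\<close>)
    ultimately show "y \<in> ?A" using \<kappa> y trace_of_eq_iff[OF y] by auto
  qed
  moreover have "openin CO (?pre \<kappa>)" if "\<kappa> \<in> Rep_plus" for \<kappa>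
    using openin_continuous_map_preimage[OF continuous_map_precompose V, of \<kappa>] Rep_plusD[OF that]
    by (simp add: topspace_compact_open)
  then have "openin CO (\<Union>\<kappa>\<in>Rep_plus. ?pre \<kappa>)" by blast
  ultimately show "openin (dpath_space X u v) ?A" using openin_dpath_space by simp
qed blast

lemma continuous_map_into_trace_spaceE:
  assumes "continuous_map Z (trace_space X u v) h" "w \<in> topspace Z"
  obtains x where "x \<in> dpaths_between X u v" "h w = trace_of X u v x"
proof -
  have "h w \<in> topspace (trace_space X u v)"
    using continuous_map_funspace[OF assms(1)] assms(2) by (rule funcset_mem)
  then have "h w \<in> trace_of X u v ` dpaths_between X u v" by simp
  then show ?thesis by (rule imageE) (rule that)
qed

text \<open>This is lower semicontinuity of \<open>h\<close> as a set-valued map, the form in which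
  continuity into the trace space enters the compactness and lifting arguments.\<close>

lemma openin_preimage_of_saturation:
  assumes "continuous_map Z (trace_space X u v) h" "openin CO V"
  shows "openin Z {w \<in> topspace Z. h w \<inter> V \<noteq> {}}"
proof -
  have "h w \<in> trace_of X u v ` (V \<inter> dpaths_between X u v) \<longleftrightarrow> h w \<inter> V \<noteq> {}" if "w \<in> topspace Z" for w
  proof -
    obtain x where x: "x \<in> dpaths_between X u v" "h w = trace_of X u v x"
      by (rule continuous_map_into_trace_spaceE[OF assms(1) \<open>w \<in> topspace Z\<close>])
    then show ?thesis
    proof -
      have "trace_of X u v x \<in> trace_of X u v ` (V \<inter> dpaths_between X u v) \<longleftrightarrow>
        (\<exists>y \<in> V \<inter> dpaths_between X u v. trace_equivalent X x y)"
        using trace_of_eq_iff[OF x(1)] by (auto simp: image_iff)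
      then show ?thesis using x(2) by (auto simp: trace_of_def)
    qed
  qed
  then have "{w \<in> topspace Z. h w \<inter> V \<noteq> {}} =
      {w \<in> topspace Z. h w \<in> trace_of X u v ` (V \<inter> dpaths_between X u v)}" by blast
  then show ?thesis
    using openin_continuous_map_preimage[OF assms(1) openin_trace_space_image[OF assms(2)]] by simp
qed

section \<open>Compactness of the union of the traces\<close>

text \<open>All members of a trace have the same image, so when \<open>h w\<close> is a trace the
  inner union is the image of any one member.\<close>

definition support :: "'b set \<Rightarrow> ('b \<Rightarrow> (real \<Rightarrow> 'a) set) \<Rightarrow> 'a set" where
  "support S h = (\<Union>w\<in>S. \<Union>x\<in>h w. x ` {0..1})"

text \<open>No continuous choice of representatives is available yet. Instead, a finite subfamily
  covering one representative of \<open>h w\<close> covers some representative of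
  \<open>h w'\<close> for all \<open>w'\<close> near \<open>w\<close>, by lower semicontinuity, and
  hence all of them. Compactness of \<open>Z\<close> then leaves finitely many subfamilies.\<close>

lemma compactin_support:
  assumes Z: "compact_space Z" and h: "continuous_map Z (trace_space X u v) h"
  shows "compactin (uspace X) (support (topspace Z) h)"
  unfolding compactin_def
proof (intro conjI allI impI)
  have hw: "\<exists>x. x \<in> dpaths_between X u v \<and> h w = trace_of X u v x" if "w \<in> topspace Z" for w
    by (rule continuous_map_into_trace_spaceE[OF h that]) (intro exI conjI)
  show "support (topspace Z) h \<subseteq> topspace (uspace X)"
    unfolding support_def
  proof (intro UN_least image_subsetI)
    fix w x and t :: real assume "w \<in> topspace Z" "x \<in> h w" "t \<in> {0..1}"
    then have "x \<in> paths_in (uspace X)" 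
      using hw[of w] dpaths_between_subset by (auto simp: trace_of_def)
    then show "x t \<in> topspace (uspace X)" using \<open>t \<in> {0..1}\<close> by (rule paths_in_range)
  qed
  fix \<U> assume \<U>: "Ball \<U> (openin (uspace X)) \<and> support (topspace Z) h \<subseteq> \<Union>\<U>"
  have "\<exists>\<F>. finite \<F> \<and> \<F> \<subseteq> \<U> \<and> (\<exists>x\<in>h w. x ` {0..1} \<subseteq> \<Union>\<F>)" if w: "w \<in> topspace Z" for w
  proof -
    obtain x where x: "x \<in> dpaths_between X u v" "h w = trace_of X u v x" using hw[OF w] by blast
    have xh: "x \<in> h w" using x mem_trace_of by simp
    have "compactin (uspace X) (x ` {0..1})"
      using x(1) dpaths_between_subset
      by (intro image_compactin[of "top_of_set {0..1}"])
        (auto simp: paths_in_def pathin_def compactin_subtopology)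
    moreover have "x ` {0..1} \<subseteq> support (topspace Z) h" using w xh by (force simp: support_def)
    then have "x ` {0..1} \<subseteq> \<Union>\<U>" by (rule subset_trans) (rule conjunct2[OF \<U>])
    ultimately have "\<exists>\<F>. finite \<F> \<and> \<F> \<subseteq> \<U> \<and> x ` {0..1} \<subseteq> \<Union>\<F>"
      by (intro compactinD) (use \<U> in auto)
    then show ?thesis using xh by blast
  qed
  then obtain F where F: "\<And>w. w \<in> topspace Z \<Longrightarrow> finite (F w)" "\<And>w. w \<in> topspace Z \<Longrightarrow> F w \<subseteq> \<U>"
    "\<And>w. w \<in> topspace Z \<Longrightarrow> \<exists>x\<in>h w. x ` {0..1} \<subseteq> \<Union>(F w)"
    by metis
  define V where "V w = {x \<in> paths_in (uspace X). x ` {0..1} \<subseteq> \<Union>(F w)}" for w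
  define W where "W w = {w' \<in> topspace Z. h w' \<inter> V w \<noteq> {}}" for w
  have "openin CO (V w)" if "w \<in> topspace Z" for w
    unfolding V_def
    by (rule openin_compact_open_subbasic) (use F(2)[OF that] \<U> in auto)
  then have Wopen: "openin Z (W w)" if "w \<in> topspace Z" for w
    unfolding W_def using openin_preimage_of_saturation[OF h] that by simp
  have Win: "w \<in> W w" if w: "w \<in> topspace Z" for w
  proof -
    obtain x where x: "x \<in> h w" "x ` {0..1} \<subseteq> \<Union>(F w)" using F(3)[OF w] by blast
    have "x \<in> paths_in (uspace X)" using hw[OF w] x(1) dpaths_between_subset by (auto simp: trace_of_def)
    then show ?thesis using x w by (auto simp: W_def V_def)
  qed
  have "compactin Z (topspace Z)" using Z by (simp add: compact_space_def)
  then have "\<exists>\<F>. finite \<F> \<and> \<F> \<subseteq> W ` topspace Z \<and> topspace Z \<subseteq> \<Union>\<F>"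
    by (rule compactinD) (use Wopen Win in auto)
  then obtain S where S: "finite S" "S \<subseteq> topspace Z" "topspace Z \<subseteq> \<Union>(W ` S)"
    by (metis finite_subset_image)
  show "\<exists>\<F>. finite \<F> \<and> \<F> \<subseteq> \<U> \<and> support (topspace Z) h \<subseteq> \<Union>\<F>"
  proof (intro exI conjI)
    show "finite (\<Union>(F ` S))" using S F(1) by blast
    show "\<Union>(F ` S) \<subseteq> \<U>" using S F(2) by blast
    show "support (topspace Z) h \<subseteq> \<Union>(\<Union>(F ` S))"
      unfolding support_def
    proof (intro UN_least)
      fix w x assume w: "w \<in> topspace Z" and x: "x \<in> h w"
      then obtain s where s: "s \<in> S" "w \<in> W s" using S(3) by blast
      then obtain y where y: "y \<in> h w" "y ` {0..1} \<subseteq> \<Union>(F s)" by (auto simp: W_def V_def)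
      have "trace_equivalent X x y"
      proof -
        obtain z where "h w = trace_of X u v z" using hw[OF w] by blast
        then have "trace_equivalent X z x" "trace_equivalent X z y" using x y(1) by (simp_all add: trace_of_def)
        then show ?thesis by (metis trace_equivalent_sym trace_equivalent_trans)
      qed
      have "\<Union>(F s) \<subseteq> \<Union>(\<Union>(F ` S))" using s(1) by blast
      with y(2) show "x ` {0..1} \<subseteq> \<Union>(\<Union>(F ` S))"
        unfolding trace_equivalent_image[OF \<open>trace_equivalent X x y\<close>] by (rule subset_trans)
    qed
  qed
qed

end

section \<open>Natural parametrization of paths in a compact subspace\<close>

text \<open>The denominator \<open>Q\<close> is at least \<open>Q0 / 2\<close>, and numerator and
  denominator contribute an error of \<eta> each; this gives the factor 4. The estimate controls
  division by the total length.\<close>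

lemma normalized_quotient_close:
  fixes P :: real
  assumes P: "\<bar>P - P0\<bar> \<le> \<eta>" and Q: "\<bar>Q - Q0\<bar> \<le> \<eta>" and "0 \<le> P0" "P0 \<le> Q0" "0 < Q0" "\<eta> \<le> Q0 / 2"
  shows "\<bar>P / Q - P0 / Q0\<bar> \<le> 4 * \<eta> / Q0"
proof -
  have Qpos: "Q0 / 2 \<le> Q" "0 < Q" using assms by linarith+
  have \<eta>: "0 \<le> \<eta>" using P by linarith
  have "P / Q - P0 / Q0 = ((P - P0) + (P0 / Q0) * (Q0 - Q)) / Q"
    using Qpos assms by (simp add: field_simps)
  then have "\<bar>P / Q - P0 / Q0\<bar> = \<bar>(P - P0) + (P0 / Q0) * (Q0 - Q)\<bar> / Q"
    using Qpos by simp
  also have "\<dots> \<le> (2 * \<eta>) / (Q0 / 2)"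
  proof (rule frac_le)
    have "\<bar>(P0 / Q0) * (Q0 - Q)\<bar> \<le> 1 * \<eta>"
      unfolding abs_mult using assms \<eta> by (intro mult_mono) auto
    then show "\<bar>(P - P0) + (P0 / Q0) * (Q0 - Q)\<bar> \<le> 2 * \<eta>" using P by linarith
  qed (use Qpos assms \<eta> in auto)
  finally show ?thesis by simp
qed

text \<open>Continuity of \<open>e\<close> turns paths in \<open>M\<close> into paths in a metric
  space, where they have a Morse length; injectivity carries constancy back from there to
  \<open>M\<close>.\<close>

locale embedded_subspace =
  fixes Y :: "'a topology" and M :: "'a set" and e :: "'a \<Rightarrow> nat \<Rightarrow> real"
  assumes continuous_embedding: "continuous_map (subtopology Y M) euclidean e"
    and inj_embedding: "inj_on e M"
begin

definition paths_within :: "(real \<Rightarrow> 'a) set" where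
  "paths_within = {x \<in> paths_in Y. x ` {0..1} \<subseteq> M}"

definition path_length :: "(real \<Rightarrow> 'a) \<Rightarrow> real \<Rightarrow> real" where
  "path_length x = morse_length (e \<circ> x)"

text \<open>The choice of \<open>t\<close> is immaterial, since a path in \<open>M\<close> takes
  equal values at parameters of equal length. Such a path of length 0 is constant and is
  kept.\<close>

definition natural_path :: "(real \<Rightarrow> 'a) \<Rightarrow> real \<Rightarrow> 'a" where
  "natural_path x = (if path_length x 1 = 0 then x
     else restrict (\<lambda>s. x (SOME t. t \<in> {0..1} \<and> path_length x t = s * path_length x 1)) {0..1})"

lemma paths_within_subset: "paths_within \<subseteq> paths_in Y"
  by (auto simp: paths_within_def)

lemma paths_within_mem: "x \<in> paths_within \<Longrightarrow> t \<in> {0..1} \<Longrightarrow> x t \<in> M"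
  by (auto simp: paths_within_def)

lemma continuous_on_embedded_path:
  assumes "x \<in> paths_within" shows "continuous_on {0..1} (e \<circ> x)"
proof -
  have "continuous_map (top_of_set {0..1}) (subtopology Y M) x"
    using assms by (auto simp: paths_within_def paths_in_def pathin_def continuous_map_in_subtopology)
  then have "continuous_map (top_of_set {0..1}) euclidean (e \<circ> x)"
    by (rule continuous_map_compose[OF _ continuous_embedding])
  then show ?thesis by simp
qed

lemma continuous_on_path_length: "x \<in> paths_within \<Longrightarrow> continuous_on {0..1} (path_length x)"
  unfolding path_length_def by (rule continuous_on_morse_length[OF continuous_on_embedded_path])

lemma path_length_0 [simp]: "path_length x 0 = 0"
  by (simp add: path_length_def)

lemma path_length_mono: "0 \<le> s \<Longrightarrow> s \<le> t \<Longrightarrow> path_length x s \<le> path_length x t"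
  unfolding path_length_def by (rule morse_length_mono)

lemma path_length_nonneg: "0 \<le> t \<Longrightarrow> 0 \<le> path_length x t"
  unfolding path_length_def by (rule morse_length_nonneg)

lemma path_length_le_1: "0 \<le> t \<Longrightarrow> path_length x t \<le> 1"
  unfolding path_length_def by (rule morse_length_le_1)

lemma path_length_eq_imp_eq:
  assumes x: "x \<in> paths_within" and st: "s \<in> {0..1}" "t \<in> {0..1}" and eq: "path_length x s = path_length x t"
  shows "x s = x t"
proof -
  have *: "x b = x a" if "a \<in> {0..1}" "b \<in> {0..1}" "a \<le> b" "path_length x a = path_length x b" for a b
  proof -
    have "(e \<circ> x) b = (e \<circ> x) a"
      by (rule morse_length_eq_imp_const[OF continuous_on_embedded_path[OF x], where b = b])
        (use that in \<open>auto simp: path_length_def\<close>)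
    then show ?thesis using inj_embedding paths_within_mem[OF x] that by (auto dest: inj_onD)
  qed
  show ?thesis
  proof (cases "s \<le> t")
    case True
    from *[OF st True eq] show ?thesis by simp
  next
    case False
    from *[OF st(2,1) _ eq[symmetric]] False show ?thesis by simp
  qed
qed

lemma path_length_eq_0_imp_const:
  assumes "x \<in> paths_within" "path_length x 1 = 0" "t \<in> {0..1}" shows "x t = x 0"
proof (rule path_length_eq_imp_eq[OF assms(1) assms(3)])
  show "path_length x t = path_length x 0"
    using path_length_mono[of t 1 x] path_length_nonneg[of t x] assms by simp
qed simp

lemma path_length_compose:
  assumes "\<phi> \<in> Rep_plus" "t \<in> {0..1}"
  shows "path_length (compose {0..1} x \<phi>) t = path_length x (\<phi> t)"
  unfolding path_length_def
  by (rule morse_length_reparametrize) (use Rep_plusD[OF assms(1)] assms(2) in \<open>auto simp: compose_def\<close>)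

lemma natural_parameter_in_Rep_plus:
  assumes x: "x \<in> paths_within" and L: "path_length x 1 \<noteq> 0"
  shows "restrict (\<lambda>t. path_length x t / path_length x 1) {0..1} \<in> Rep_plus"
proof (rule Rep_plusI)
  have "0 < path_length x 1" using L path_length_nonneg[of 1 x] by simp
  then show "mono_on {0..1} (\<lambda>t. path_length x t / path_length x 1)"
    by (intro mono_onI divide_right_mono path_length_mono) auto
  show "continuous_on {0..1} (\<lambda>t. path_length x t / path_length x 1)"
    by (intro continuous_intros continuous_on_path_length[OF x]) (use L in simp)
qed (use L in auto)

lemma natural_parameter_surj:
  assumes "x \<in> paths_within" "path_length x 1 \<noteq> 0" "s \<in> {0..1}"
  obtains t where "t \<in> {0..1}" "path_length x t / path_length x 1 = s"
proof -
  have "s \<in> restrict (\<lambda>t. path_length x t / path_length x 1) {0..1} ` {0..1}"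
    using Rep_plusD(3)[OF natural_parameter_in_Rep_plus[OF assms(1,2)]] assms(3) by simp
  then show ?thesis using that by auto
qed

lemma natural_parameter_range:
  assumes "t \<in> {0..1}" shows "path_length x t / path_length x 1 \<in> {0..1}"
  using assms path_length_nonneg[of t x] path_length_nonneg[of 1 x] path_length_mono[of t 1 x]
  by (auto simp: divide_le_eq_1)

lemma natural_path_parameter:
  assumes x: "x \<in> paths_within" and L: "path_length x 1 \<noteq> 0" and t: "t \<in> {0..1}"
  shows "natural_path x (path_length x t / path_length x 1) = x t"
proof -
  let ?s = "path_length x t / path_length x 1"
  have s: "?s \<in> {0..1}" by (rule natural_parameter_range[OF t])
  have ex: "t \<in> {0..1} \<and> path_length x t = ?s * path_length x 1" using t L by simp
  define t' where "t' = (SOME t. t \<in> {0..1} \<and> path_length x t = ?s * path_length x 1)"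
  have "t' \<in> {0..1} \<and> path_length x t' = ?s * path_length x 1"
    unfolding t'_def using ex by (rule someI)
  then have "x t' = x t" using L t by (intro path_length_eq_imp_eq[OF x]) auto
  then show ?thesis using s L by (simp add: natural_path_def t'_def)
qed

lemma natural_path_image:
  assumes x: "x \<in> paths_within" shows "natural_path x ` {0..1} \<subseteq> x ` {0..1}"
proof (cases "path_length x 1 = 0")
  case False
  show ?thesis
  proof
    fix p assume "p \<in> natural_path x ` {0..1}"
    then obtain s where s: "s \<in> {0..1}" "p = natural_path x s" by blast
    from natural_parameter_surj[OF x False s(1)] obtain t
      where "t \<in> {0..1}" "path_length x t / path_length x 1 = s" .
    then show "p \<in> x ` {0..1}" using natural_path_parameter[OF x False] s(2) by blast
  qed
qed (simp add: natural_path_def)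

text \<open>The normalized length is a continuous surjection of the compact interval, hence a closed
  map. So the preimage of a closed set under the natural path, being the image of its preimage under
  \<open>x\<close>, is closed.\<close>

lemma natural_path_in_paths_within:
  assumes x: "x \<in> paths_within" shows "natural_path x \<in> paths_within"
proof (cases "path_length x 1 = 0")
  case False
  let ?\<phi> = "\<lambda>t. path_length x t / path_length x 1"
  have xp: "continuous_map (top_of_set {0..1}) Y x"
    using x by (simp add: paths_within_def paths_in_def pathin_def)
  have "continuous_map (top_of_set {0..1}) Y (natural_path x)"
    unfolding continuous_map_closedin
  proof (intro conjI allI impI Pi_I)
    fix s :: real assume "s \<in> topspace (top_of_set {0..1})"
    then have "natural_path x s \<in> x ` {0..1}" using natural_path_image[OF x] by auto
    then show "natural_path x s \<in> topspace Y"
      using paths_in_range[of x Y] x by (auto simp: paths_within_def)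
  next
    fix C assume C: "closedin Y C"
    let ?A = "{t \<in> {0..1}. x t \<in> C}"
    have "closedin (top_of_set {0..1}) ?A"
      using closedin_continuous_map_preimage[OF xp C] by simp
    then have "compact ?A" using closedin_compact by blast
    moreover have "continuous_on ?A ?\<phi>"
      by (intro continuous_intros continuous_on_subset[OF continuous_on_path_length[OF x]]) (use False in auto)
    ultimately have "compact (?\<phi> ` ?A)" by (rule compact_continuous_image[rotated])
    moreover have "{s \<in> {0..1}. natural_path x s \<in> C} = ?\<phi> ` ?A"
    proof (intro equalityI subsetI)
      fix s assume s: "s \<in> {s \<in> {0..1}. natural_path x s \<in> C}"
      then obtain t where t: "t \<in> {0..1}" "?\<phi> t = s"
        by (metis (mono_tags, lifting) natural_parameter_surj[OF x False] mem_Collect_eq)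
      have "x t \<in> C" using natural_path_parameter[OF x False t(1)] t(2) s by simp
      then show "s \<in> ?\<phi> ` ?A" using t by blast
    next
      fix s assume "s \<in> ?\<phi> ` ?A"
      then obtain t where t: "t \<in> {0..1}" "x t \<in> C" "s = ?\<phi> t" by blast
      moreover have "?\<phi> t \<in> {0..1}"
        by (rule natural_parameter_range[OF t(1)])
      ultimately show "s \<in> {s \<in> {0..1}. natural_path x s \<in> C}"
        using natural_path_parameter[OF x False t(1)] by simp
    qed
    ultimately have "closed {s \<in> {0..1}. natural_path x s \<in> C}" by (metis compact_imp_closed)
    then have "closedin (top_of_set {0..1}) {s \<in> {0..1}. natural_path x s \<in> C}"
      by (rule closed_subset[rotated]) blast
    then show "closedin (top_of_set {0..1}) {s \<in> topspace (top_of_set {0..1}). natural_path x s \<in> C}"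
      by simp
  qed
  moreover have "natural_path x \<in> extensional {0..1}" using False by (simp add: natural_path_def)
  moreover have "natural_path x ` {0..1} \<subseteq> M"
    using natural_path_image[OF x] x by (auto simp: paths_within_def)
  ultimately show ?thesis by (simp add: paths_within_def paths_in_def pathin_def)
qed (simp add: natural_path_def x)

lemma compose_natural_path:
  assumes x: "x \<in> paths_within" and L: "path_length x 1 \<noteq> 0"
    and \<phi>: "\<And>t. t \<in> {0..1} \<Longrightarrow> \<phi> t = path_length x t / path_length x 1"
  shows "compose {0..1} (natural_path x) \<phi> = x"
proof (rule extensionalityI[of _ "{0..1}"])
  show "x \<in> extensional {0..1}" using x by (simp add: paths_within_def paths_in_def)
  show "compose {0..1} (natural_path x) \<phi> t = x t" if "t \<in> {0..1}" for t
    using that natural_path_parameter[OF x L] \<phi> by (simp add: compose_def)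
qed simp

lemma natural_path_factorization:
  assumes x: "x \<in> paths_within"
  shows "\<exists>\<phi>\<in>Rep_plus. compose {0..1} (natural_path x) \<phi> = x"
proof (cases "path_length x 1 = 0")
  case True
  have "compose {0..1} x (restrict (\<lambda>t. t) {0..1}) = x"
    by (rule extensionalityI[of _ "{0..1}"]) (use x in \<open>auto simp: compose_def paths_within_def paths_in_def\<close>)
  then show ?thesis using True Rep_plus_id by (auto simp: natural_path_def)
next
  case False
  show ?thesis
    by (rule bexI[OF compose_natural_path[OF x False] natural_parameter_in_Rep_plus[OF x False]]) simp
qed

lemma compose_in_paths_within:
  assumes "x \<in> paths_within" "\<phi> \<in> Rep_plus" shows "compose {0..1} x \<phi> \<in> paths_within"
proof -
  have "compose {0..1} x \<phi> \<in> paths_in Y"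
    using assms(1) by (intro compose_in_paths_in Rep_plusD[OF assms(2)]) (auto simp: paths_within_def Rep_plusD(3)[OF assms(2)])
  moreover have "compose {0..1} x \<phi> ` {0..1} = x ` {0..1}"
    by (simp add: compose_image Rep_plusD(3)[OF assms(2)])
  ultimately show ?thesis using assms(1) by (simp add: paths_within_def)
qed

text \<open>The parameter \<open>t\<close> of the composite and the parameter
  \<open>\<phi> t\<close> of \<open>x\<close> have the same normalized length and the same value.
  For length 0 both sides are the same constant path.\<close>

lemma natural_path_compose:
  assumes x: "x \<in> paths_within" and \<phi>: "\<phi> \<in> Rep_plus"
  shows "natural_path (compose {0..1} x \<phi>) = natural_path x"
proof -
  let ?y = "compose {0..1} x \<phi>"
  have y: "?y \<in> paths_within" by (rule compose_in_paths_within[OF x \<phi>])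
  have len: "path_length ?y t = path_length x (\<phi> t)" if "t \<in> {0..1}" for t
    by (rule path_length_compose[OF \<phi> that])
  have len1: "path_length ?y 1 = path_length x 1" using len[of 1] Rep_plusD[OF \<phi>] by simp
  have ext: "natural_path ?y \<in> extensional {0..1}" "natural_path x \<in> extensional {0..1}"
    using natural_path_in_paths_within[OF x] natural_path_in_paths_within[OF y]
    by (auto simp: paths_within_def paths_in_def)
  show ?thesis
  proof (rule extensionalityI[OF ext])
    fix s :: real assume s: "s \<in> {0..1}"
    show "natural_path ?y s = natural_path x s"
    proof (cases "path_length x 1 = 0")
      case True
      have "\<phi> s \<in> {0..1}" using Rep_plusD(3)[OF \<phi>] s by blast
      then have "x (\<phi> s) = x s"
        using path_length_eq_0_imp_const[OF x True] s by metis
      then show ?thesis using True len1 s by (simp add: natural_path_def compose_def)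
    next
      case False
      then obtain t where t: "t \<in> {0..1}" "path_length ?y t / path_length ?y 1 = s"
        using natural_parameter_surj[OF y _ s] len1 by metis
      have \<phi>t: "\<phi> t \<in> {0..1}" using Rep_plusD(3)[OF \<phi>] t by blast
      have "natural_path ?y s = ?y t" using natural_path_parameter[OF y _ t(1)] False len1 t(2) by simp
      also have "\<dots> = x (\<phi> t)" using t by (simp add: compose_def)
      also have "\<dots> = natural_path x s"
        using natural_path_parameter[OF x False \<phi>t] t(2) len[OF t(1)] len1 by simp
      finally show ?thesis .
    qed
  qed
qed

text \<open>Finitely many short intervals on which the image of \<open>x0\<close> barely moves turn
  uniform closeness under \<open>e\<close> into finitely many subbasic conditions.\<close>

lemma path_length_continuous:
  assumes x0: "x0 \<in> paths_within" and \<eta>: "\<eta> > 0"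
  shows "\<exists>V. openin (compact_open_topology Y) V \<and> x0 \<in> V \<and>
    (\<forall>x \<in> V \<inter> paths_within. \<forall>t\<in>{0..1}. \<bar>path_length x t - path_length x0 t\<bar> \<le> \<eta>)"
proof -
  have x0p: "x0 \<in> paths_in Y" using x0 paths_within_subset by blast
  obtain d where d: "d > 0" and
    unif: "\<And>s s'. s \<in> {0..1} \<Longrightarrow> s' \<in> {0..1} \<Longrightarrow> dist s' s < d \<Longrightarrow> dist (e (x0 s')) (e (x0 s)) < \<eta>/4"
    using compact_uniformly_continuous[OF continuous_on_embedded_path[OF x0] compact_Icc] \<eta>
    unfolding uniformly_continuous_on_def comp_def by (metis zero_less_divide_iff zero_less_numeral)
  \<comment> \<open>Preimages of balls under \<open>e\<close> are open only relative to
    \<open>M\<close>, whereas the compact-open topology needs open sets of \<open>Y\<close>.\<close>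
  have "\<exists>U. openin Y U \<and> (\<forall>p\<in>M. p \<in> U \<longleftrightarrow> p \<in> topspace Y \<and> dist (e p) (e (x0 t)) < \<eta>/4)" for t
  proof -
    have "openin (subtopology Y M) {p \<in> topspace (subtopology Y M). e p \<in> ball (e (x0 t)) (\<eta>/4)}"
      by (rule openin_continuous_map_preimage[OF continuous_embedding]) simp
    then obtain U where "openin Y U" "{p \<in> topspace (subtopology Y M). e p \<in> ball (e (x0 t)) (\<eta>/4)} = U \<inter> M"
      unfolding openin_subtopology by blast
    then show ?thesis by (intro exI[of _ U]) (auto simp: dist_commute)
  qed
  then obtain U where U: "\<And>t. openin Y (U t)"
    "\<And>t p. p \<in> M \<Longrightarrow> p \<in> U t \<longleftrightarrow> p \<in> topspace Y \<and> dist (e p) (e (x0 t)) < \<eta>/4"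
    by metis
  have cover: "{0..1::real} \<subseteq> (\<Union>t\<in>{0..1}. ball t (d/2))"
  proof
    fix t :: real assume "t \<in> {0..1}"
    moreover have "t \<in> ball t (d/2)" using d by simp
    ultimately show "t \<in> (\<Union>t\<in>{0..1}. ball t (d/2))" by blast
  qed
  obtain F :: "real set" where F: "F \<subseteq> {0..1}" "finite F" "{0..1} \<subseteq> (\<Union>t\<in>F. ball t (d/2))"
    by (rule compactE_image[OF compact_Icc _ cover]) auto
  define K where "K t = {0..1} \<inter> cball t (d/2)" for t :: real
  define V where "V = (\<Inter>t\<in>F. {x \<in> paths_in Y. x ` K t \<subseteq> U t}) \<inter> paths_in Y"
  have "openin (compact_open_topology Y) ((\<Inter>t\<in>F. {x \<in> paths_in Y. x ` K t \<subseteq> U t}) \<inter> topspace (compact_open_topology Y))"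
    by (rule openin_INT[OF F(2)], rule openin_compact_open_subbasic) (auto simp: K_def U)
  then have "openin (compact_open_topology Y) V" by (simp add: V_def topspace_compact_open)
  moreover have "x0 \<in> V"
  proof -
    have "x0 s \<in> U t" if "t \<in> F" "s \<in> K t" for s t
    proof -
      have s: "s \<in> {0..1}" "dist s t < d" using that d by (auto simp: K_def dist_commute)
      then have "dist (e (x0 s)) (e (x0 t)) < \<eta>/4" using unif that(1) F(1) by blast
      then show ?thesis
        using U(2)[OF paths_within_mem[OF x0 s(1)]] paths_in_range[OF x0p s(1)] by simp
    qed
    then show ?thesis using x0p by (auto simp: V_def)
  qed
  moreover have "\<bar>path_length x t - path_length x0 t\<bar> \<le> \<eta>" if x: "x \<in> V \<inter> paths_within" and t: "t \<in> {0..1}" for x t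
  proof -
    \<comment> \<open>Two distances below \<open>\<eta>/4\<close>, both measured to the centre value
      at \<open>r\<close>, give \<open>\<eta>/2\<close>; comparing lengths doubles it.\<close>
    have "\<bar>path_length x t - path_length x0 t\<bar> \<le> 2 * (\<eta>/2)"
      unfolding path_length_def
    proof (rule morse_length_close)
      fix s assume "s \<in> {0..t}"
      then have s: "s \<in> {0..1}" using t by auto
      then obtain r where r: "r \<in> F" "dist r s < d/2" using F(3) by auto
      then have sK: "s \<in> K r" using s by (simp add: K_def)
      have "x s \<in> U r" using x r(1) sK by (auto simp: V_def)
      then have "dist (e (x s)) (e (x0 r)) < \<eta>/4"
        using U(2)[of "x s" r] paths_within_mem[of x s] s x by blast
      moreover have "dist (e (x0 s)) (e (x0 r)) < \<eta>/4"
        by (rule unif) (use r F s d in \<open>auto simp: dist_commute\<close>)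
      moreover have "dist (e (x s)) (e (x0 s)) \<le> dist (e (x s)) (e (x0 r)) + dist (e (x0 s)) (e (x0 r))"
        by metric
      ultimately show "dist ((e \<circ> x) s) ((e \<circ> x0) s) \<le> \<eta>/2" by simp
    qed (use t \<eta> in auto)
    then show ?thesis by simp
  qed
  ultimately show ?thesis by blast
qed

text \<open>Near a constant path the whole image stays in \<open>U\<close>, and natural paths add no
  new values. Near a path of positive length, a point of \<open>K\<close> is the normalized length
  in \<open>x\<close> of some \<open>t\<close>; its normalized length in \<open>x0\<close> is then
  close to \<open>K\<close>, which confines \<open>t\<close> to a compact set sent into
  \<open>U\<close>.\<close>

lemma continuous_map_natural_path:
  "continuous_map (subtopology (compact_open_topology Y) paths_within) (compact_open_topology Y) natural_path"
proof (rule continuous_map_into_compact_open)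
  let ?S = "subtopology (compact_open_topology Y) paths_within"
  have topS: "topspace ?S = paths_within"
    using paths_within_subset by (auto simp: topspace_compact_open)
  show "natural_path ` topspace ?S \<subseteq> paths_in Y"
    unfolding topS using natural_path_in_paths_within paths_within_subset by blast
  fix K :: "real set" and U assume K: "compact K" "K \<subseteq> {0..1}" and U: "openin Y U"
  show "openin ?S {x \<in> topspace ?S. natural_path x ` K \<subseteq> U}"
    unfolding topS
  proof (subst openin_subopen, intro ballI)
    fix x0 assume "x0 \<in> {x \<in> paths_within. natural_path x ` K \<subseteq> U}"
    then have x0: "x0 \<in> paths_within" and x0K: "natural_path x0 ` K \<subseteq> U" by auto
    have x0p: "x0 \<in> paths_in Y" using x0 paths_within_subset by blast
    define L where "L = path_length x0 1"
    have openS: "openin ?S (V \<inter> paths_within)" if "openin (compact_open_topology Y) V" for V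
      using that by (rule openin_subtopology_Int)
    show "\<exists>T. openin ?S T \<and> x0 \<in> T \<and> T \<subseteq> {x \<in> paths_within. natural_path x ` K \<subseteq> U}"
    proof (cases "L = 0")
      case True
      show ?thesis
      proof (cases "K = {}")
        case True
        then show ?thesis using x0 openin_topspace[of ?S] unfolding topS by auto
      next
        case False
        then obtain s where s: "s \<in> K" by blast
        have "natural_path x0 s = x0 s" using True by (simp add: natural_path_def L_def)
        then have "x0 s \<in> U" using x0K s by (metis image_subset_iff)
        then have "x0 ` {0..1} \<subseteq> U"
          using path_length_eq_0_imp_const[OF x0] True s K(2) unfolding L_def
          by (metis image_subsetI subsetD)
        moreover have "natural_path x ` K \<subseteq> U" if "x ` {0..1} \<subseteq> U" "x \<in> paths_within" for x
          using natural_path_image[OF that(2)] that(1) K(2) by blast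
        moreover have "openin ?S ({x \<in> paths_in Y. x ` {0..1} \<subseteq> U} \<inter> paths_within)"
          by (intro openS openin_compact_open_subbasic U) auto
        ultimately show ?thesis
          using x0 x0p by (intro exI[of _ "{x \<in> paths_in Y. x ` {0..1} \<subseteq> U} \<inter> paths_within"]) blast
      qed
    next
      case False
      then have L: "0 < L" using path_length_nonneg[of 1 x0] by (simp add: L_def)
      have nat0: "natural_path x0 \<in> paths_in Y" using natural_path_in_paths_within[OF x0] paths_within_subset by blast
      obtain C \<epsilon> where C: "compact C" "C \<subseteq> {0..1}" "natural_path x0 ` C \<subseteq> U" and \<epsilon>: "\<epsilon> > 0"
        and near: "\<And>s s'. s \<in> K \<Longrightarrow> s' \<in> {0..1} \<Longrightarrow> \<bar>s' - s\<bar> \<le> \<epsilon> \<Longrightarrow> s' \<in> C"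
        by (rule path_compact_thickening[OF nat0 U K x0K]) blast
      \<comment> \<open>These are the parameters of \<open>x0\<close> whose normalized length lies
        in the thickening \<open>C\<close> of \<open>K\<close>.\<close>
      define K' where "K' = {0..1} \<inter> (\<lambda>t. path_length x0 t / L) -` C"
      have "closed K'"
        unfolding K'_def
        by (intro continuous_closed_preimage continuous_intros continuous_on_path_length[OF x0] 
            compact_imp_closed C(1)) (use L in auto)
      then have K': "compact K'" "K' \<subseteq> {0..1}"
        unfolding K'_def by (auto simp: compact_eq_bounded_closed intro: bounded_subset[OF bounded_closed_interval])
      have x0K': "x0 ` K' \<subseteq> U"
      proof
        fix p assume "p \<in> x0 ` K'"
        then obtain t where t: "t \<in> {0..1}" "path_length x0 t / L \<in> C" "p = x0 t" by (auto simp: K'_def)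
        then have "natural_path x0 (path_length x0 t / L) \<in> U" using C(3) by blast
        then show "p \<in> U" using natural_path_parameter[OF x0 _ t(1)] False t(3) by (simp add: L_def)
      qed
      \<comment> \<open>The bound \<open>L/4\<close> keeps the total length of nearby paths
        positive; the other one makes the quotient error \<open>4 * \<eta> / L\<close> at most
        \<epsilon>.\<close>
      define \<eta> where "\<eta> = min (L/4) (L * \<epsilon> / 4)"
      have \<eta>: "\<eta> > 0" "\<eta> \<le> L/4" "4 * \<eta> / L \<le> \<epsilon>"
        using L \<epsilon> by (auto simp: \<eta>_def field_simps min_def)
      obtain V where V: "openin (compact_open_topology Y) V" "x0 \<in> V"
        and close: "\<And>x t. x \<in> V \<inter> paths_within \<Longrightarrow> t \<in> {0..1} \<Longrightarrow> \<bar>path_length x t - path_length x0 t\<bar> \<le> \<eta>"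
        using path_length_continuous[OF x0 \<eta>(1)] by blast
      let ?T = "(V \<inter> {x \<in> paths_in Y. x ` K' \<subseteq> U}) \<inter> paths_within"
      show ?thesis
      proof (intro exI conjI subsetI)
        show "openin ?S ?T"
          by (intro openS openin_Int V openin_compact_open_subbasic K' U)
        show "x0 \<in> ?T" using V(2) x0p x0K' x0 by blast
        fix x assume x: "x \<in> ?T"
        then have xw: "x \<in> paths_within" by blast
        have xV: "x \<in> V \<inter> paths_within" using x by blast
        have Lx: "path_length x 1 \<noteq> 0"
          using close[OF xV, of 1] \<eta> L by (auto simp: L_def)
        have "natural_path x s \<in> U" if s: "s \<in> K" for s
        proof -
          obtain t where t: "t \<in> {0..1}" "path_length x t / path_length x 1 = s"
            using natural_parameter_surj[OF xw Lx] s K(2) by blast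
          have "\<bar>s - path_length x0 t / L\<bar> \<le> 4 * \<eta> / L"
            unfolding t(2)[symmetric]
            by (rule normalized_quotient_close)
              (use close[OF xV t(1)] close[OF xV, of 1] t(1) path_length_nonneg path_length_mono \<eta> L in \<open>auto simp: L_def\<close>)
          then have "\<bar>path_length x0 t / L - s\<bar> \<le> \<epsilon>" using \<eta>(3) by linarith
          then have "path_length x0 t / L \<in> C"
            by (intro near[OF s]) (use natural_parameter_range[OF t(1)] in \<open>simp_all add: L_def\<close>)
          then have "t \<in> K'" using t(1) by (simp add: K'_def)
          then have "x t \<in> U" using x by blast
          then show ?thesis using natural_path_parameter[OF xw Lx t(1)] t(2) by simp
        qed
        then show "x \<in> {x \<in> paths_within. natural_path x ` K \<subseteq> U}" using xw by blast
      qed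
    qed
  qed
qed

end

section \<open>Disks and simplices\<close>

lemma simplex_space_eq: "simplex_space n = top_of_set (standard_simplex n)"
  by (simp add: euclidean_product_topology)

lemma disk_eq: "disk n = top_of_set {x. (\<forall>i\<ge>n. x i = 0) \<and> (\<Sum>i<n. (x i)\<^sup>2) \<le> 1}"
  by (simp add: disk_def Euclidean_space_def subtopology_subtopology euclidean_product_topology Collect_conj_eq)

lemma boundary_sphere_eq: "boundary_sphere n = top_of_set {x. (\<forall>i\<ge>n. x i = 0) \<and> (\<Sum>i<n. (x i)\<^sup>2) = 1}"
  by (simp add: boundary_sphere_def Euclidean_space_def subtopology_subtopology euclidean_product_topology Collect_conj_eq)

definition radius :: "nat \<Rightarrow> (nat \<Rightarrow> real) \<Rightarrow> real" where
  "radius n x = L2_set x {..<n}"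

definition radial_projection :: "nat \<Rightarrow> (nat \<Rightarrow> real) \<Rightarrow> nat \<Rightarrow> real" where
  "radial_projection n x i = x i / radius n x"

lemma radius_nonneg: "0 \<le> radius n x"
  by (simp add: radius_def L2_set_nonneg)

lemma radius_le_1_iff: "radius n x \<le> 1 \<longleftrightarrow> (\<Sum>i<n. (x i)\<^sup>2) \<le> 1"
  by (simp add: radius_def L2_set_def)

lemma radius_eq_1_iff: "radius n x = 1 \<longleftrightarrow> (\<Sum>i<n. (x i)\<^sup>2) = 1"
  by (simp add: radius_def L2_set_def)

lemma topspace_disk: "topspace (disk n) = {x. (\<forall>i\<ge>n. x i = 0) \<and> radius n x \<le> 1}"
  by (simp add: disk_eq radius_le_1_iff)

lemma topspace_boundary_sphere: "topspace (boundary_sphere n) = {x. (\<forall>i\<ge>n. x i = 0) \<and> radius n x = 1}"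
  by (simp add: boundary_sphere_eq radius_eq_1_iff)

lemma continuous_on_coordinate: "continuous_on S (\<lambda>x :: nat \<Rightarrow> real. x i)"
  by (rule continuous_on_product_then_coordinatewise[OF continuous_on_id])

lemma continuous_on_radius: "continuous_on S (radius n)"
  unfolding radius_def[abs_def] L2_set_def
  by (intro continuous_intros continuous_on_coordinate)

lemma radius_divide: "c \<ge> 0 \<Longrightarrow> radius n (\<lambda>i. x i / c) = radius n x / c"
  using L2_set_right_distrib[of "1 / c" x "{..<n}"] by (simp add: radius_def mult.commute)

lemma radial_projection_in_boundary_sphere:
  assumes "x \<in> topspace (disk n)" "radius n x \<noteq> 0"
  shows "radial_projection n x \<in> topspace (boundary_sphere n)"
  using assms radius_divide[OF radius_nonneg, of n x n x]
  by (simp add: topspace_disk topspace_boundary_sphere radial_projection_def[abs_def])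

lemma continuous_map_radial_projection:
  "continuous_map (subtopology (disk n) {x. radius n x \<noteq> 0}) (boundary_sphere n) (radial_projection n)"
proof -
  let ?S = "topspace (disk n) \<inter> {x. radius n x \<noteq> 0}"
  have "continuous_on ?S (radial_projection n)"
    unfolding radial_projection_def[abs_def]
    by (intro continuous_on_coordinatewise_then_product continuous_intros continuous_on_coordinate continuous_on_radius) auto
  moreover have "radial_projection n ` ?S \<subseteq> topspace (boundary_sphere n)"
    using radial_projection_in_boundary_sphere by blast
  moreover have "subtopology (disk n) {x. radius n x \<noteq> 0} = top_of_set ?S"
    by (simp add: disk_eq subtopology_subtopology)
  moreover have "boundary_sphere n = top_of_set (topspace (boundary_sphere n))"
    by (simp add: boundary_sphere_eq)
  ultimately show ?thesis
    by (metis continuous_map_subtopology_eu image_subset_iff_funcset)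
qed

text \<open>The cube around the disk is scaled affinely into the first \<open>n\<close> barycentric
  coordinates, and the last coordinate completes the sum to 1. The retraction undoes this and pulls
  points outside the disk radially back to the sphere.\<close>

lemma disk_retract_of_simplex:
  obtains r i where "continuous_map (simplex_space n) (disk n) r"
    "continuous_map (disk n) (simplex_space n) i" "\<And>z. z \<in> topspace (disk n) \<Longrightarrow> r (i z) = z"
proof -
  define i :: "(nat \<Rightarrow> real) \<Rightarrow> nat \<Rightarrow> real" where
    "i x j = (if j < n then (x j + 1) / (2 * real n) else if j = n then 1 - (\<Sum>k<n. (x k + 1) / (2 * real n)) else 0)" for x j
  define a :: "(nat \<Rightarrow> real) \<Rightarrow> nat \<Rightarrow> real" where
    "a y j = (if j < n then 2 * real n * y j - 1 else 0)" for y j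
  define r :: "(nat \<Rightarrow> real) \<Rightarrow> nat \<Rightarrow> real" where
    "r y j = a y j / max 1 (radius n (a y))" for y j
  have conta: "continuous_on S a" for S
    unfolding a_def[abs_def]
  proof (intro continuous_on_coordinatewise_then_product)
    fix j show "continuous_on S (\<lambda>y. if j < n then 2 * real n * y j - 1 else 0)"
      by (cases "j < n") (auto intro!: continuous_intros continuous_on_coordinate)
  qed
  have "continuous_on S (radius n \<circ> a)" for S
    by (rule continuous_on_compose[OF conta continuous_on_radius])
  then have contr: "continuous_on S r" for S
    unfolding r_def[abs_def] comp_def
    by (intro continuous_on_coordinatewise_then_product continuous_intros
        continuous_on_product_then_coordinatewise[OF conta]) auto
  have conti: "continuous_on S i" for S
    unfolding i_def[abs_def]
  proof (intro continuous_on_coordinatewise_then_product)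
    fix j show "continuous_on S (\<lambda>x. if j < n then (x j + 1) / (2 * real n)
        else if j = n then 1 - (\<Sum>k<n. (x k + 1) / (2 * real n)) else 0)"
    proof (cases "j < n")
      case True
      then show ?thesis by (auto intro!: continuous_intros continuous_on_coordinate)
    next
      case False
      then show ?thesis
        by (cases "n = 0"; cases "j = n") (auto intro!: continuous_intros continuous_on_coordinate)
    qed
  qed
  have r_in: "r y \<in> topspace (disk n)" for y
  proof -
    have "radius n (r y) = radius n (a y) / max 1 (radius n (a y))"
      unfolding r_def[abs_def] by (rule radius_divide) simp
    also have "\<dots> \<le> 1" by (simp add: divide_le_eq_1 max_def)
    finally show ?thesis by (simp add: topspace_disk r_def a_def)
  qed
  have i_in: "i x \<in> standard_simplex n" if x: "x \<in> topspace (disk n)" for x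
  proof -
    have bound: "\<bar>x k\<bar> \<le> 1" if "k < n" for k
    proof -
      have "\<bar>x k\<bar> \<le> radius n x" unfolding radius_def
        using member_le_L2_set[of "{..<n}" k "\<lambda>k. \<bar>x k\<bar>"] that by (simp add: L2_set_def)
      then show ?thesis using x by (simp add: topspace_disk)
    qed
    have i_bound: "0 \<le> i x k \<and> i x k \<le> 1 / n" if "k < n" for k
      using bound[OF that] that by (auto simp: i_def field_simps abs_le_iff)
    have sum_le: "(\<Sum>k<n. i x k) \<le> 1"
    proof (cases "n = 0")
      case False
      have "(\<Sum>k<n. i x k) \<le> (\<Sum>k<n. 1 / n)" by (rule sum_mono) (use i_bound in auto)
      then show ?thesis using False by simp
    qed simp
    have sum_nonneg: "0 \<le> (\<Sum>k<n. i x k)" by (rule sum_nonneg) (use i_bound in auto)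
    have sum_eq: "(\<Sum>k<n. (x k + 1) / (2 * real n)) = (\<Sum>k<n. i x k)" by (rule sum.cong) (auto simp: i_def)
    have i_n: "i x n = 1 - (\<Sum>k<n. i x k)" unfolding sum_eq[symmetric] by (simp add: i_def)
    have "0 \<le> i x j \<and> i x j \<le> 1" for j
    proof -
      consider "j < n" | "j = n" | "j > n" by linarith
      then show ?thesis
      proof cases
        case 1
        moreover have "1 / real n \<le> 1" using 1 by simp
        ultimately show ?thesis using i_bound[OF 1] by linarith
      next
        case 2
        then show ?thesis using i_n sum_le sum_nonneg by simp
      qed (simp add: i_def)
    qed
    moreover have "i x j = 0" if "j > n" for j using that by (simp add: i_def)
    moreover have "(\<Sum>j\<le>n. i x j) = 1"
      using i_n by (simp add: lessThan_Suc_atMost[symmetric])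
    ultimately show ?thesis unfolding standard_simplex_def by blast
  qed
  have ri: "r (i x) = x" if x: "x \<in> topspace (disk n)" for x
  proof -
    have "a (i x) = x" using x by (auto simp: a_def i_def topspace_disk fun_eq_iff field_simps)
    moreover have "max 1 (radius n x) = 1" using x by (simp add: topspace_disk)
    ultimately show ?thesis by (intro ext) (simp add: r_def)
  qed
  have disk_eu: "disk n = top_of_set (topspace (disk n))" by (simp add: disk_eq)
  show thesis
  proof (rule that[of r i])
    show "continuous_map (simplex_space n) (disk n) r"
      unfolding simplex_space_eq by (subst disk_eu) (use contr r_in in auto)
    show "continuous_map (disk n) (simplex_space n) i"
      unfolding simplex_space_eq by (subst disk_eu) (use conti i_in in auto)
  qed (rule ri)
qed

lemma compact_space_simplex: "compact_space (simplex_space n)"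
  by (rule compact_space_subtopology[OF compactin_standard_simplex])

lemma compact_space_disk: "compact_space (disk n)"
proof -
  obtain r i where r: "continuous_map (simplex_space n) (disk n) r"
    and i: "continuous_map (disk n) (simplex_space n) i" and ri: "\<And>z. z \<in> topspace (disk n) \<Longrightarrow> r (i z) = z"
    using disk_retract_of_simplex by blast
  have "topspace (disk n) \<subseteq> r ` topspace (simplex_space n)"
  proof
    fix z assume z: "z \<in> topspace (disk n)"
    then have "i z \<in> topspace (simplex_space n)" using continuous_map_funspace[OF i] by (rule funcset_mem[rotated])
    then show "z \<in> r ` topspace (simplex_space n)" using ri[OF z] by (metis imageI)
  qed
  then have "r ` topspace (simplex_space n) = topspace (disk n)"
    using continuous_map_image_subset_topspace[OF r] by (rule subset_antisym[rotated])
  then show ?thesis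
    using image_compactin[OF compact_space_simplex[unfolded compact_space_def] r]
    by (simp add: compact_space_def)
qed

text \<open>After the retraction \<open>f\<close> becomes a simplex, which \<open>k_Delta\<close>
  does not distinguish from a simplex of \<open>Y\<close>; restricting along the section recovers
  \<open>f\<close>.\<close>

lemma continuous_map_disk_k_Delta:
  assumes f: "continuous_map (disk n) Y f" shows "continuous_map (disk n) (k_Delta Y) f"
proof -
  obtain r i where r: "continuous_map (simplex_space n) (disk n) r"
    and i: "continuous_map (disk n) (simplex_space n) i" and ri: "\<And>z. z \<in> topspace (disk n) \<Longrightarrow> r (i z) = z"
    using disk_retract_of_simplex by blast
  have "continuous_map (simplex_space n) (k_Delta Y) (f \<circ> r)"
    unfolding continuous_map_simplex_k_Delta by (rule continuous_map_compose[OF r f])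
  then have "continuous_map (disk n) (k_Delta Y) ((f \<circ> r) \<circ> i)"
    by (rule continuous_map_compose[OF i])
  then show ?thesis by (rule continuous_map_eq) (simp add: ri)
qed

section \<open>Lifting\<close>

context saturated_dspace begin

lemma compactin_embedding:
  assumes M: "compactin (uspace X) M"
  obtains e where "embedded_subspace (uspace X) M e"
proof -
  have top: "topspace (subtopology (uspace X) M) = M"
    using compactin_subset_topspace[OF M] by auto
  have "\<exists>e :: 'a \<Rightarrow> nat \<Rightarrow> real. continuous_map (subtopology (uspace X) M) euclidean e \<and>
      inj_on e (topspace (subtopology (uspace X) M))"
    by (intro compact_Hausdorff_second_countable_embedding compact_space_subtopology[OF M]
        Hausdorff_space_subtopology Hausdorff second_countable_subtopology second_countable)
  then show ?thesis using that unfolding embedded_subspace_def top by blast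
qed

context
  fixes M e
  assumes embedded: "embedded_subspace (uspace X) M e"
begin

interpretation embedded_subspace "uspace X" M e by (rule embedded)

lemma natural_path_eq_if_trace_equivalent:
  assumes "trace_equivalent X x y" "x \<in> paths_within"
  shows "natural_path x = natural_path y"
proof -
  \<comment> \<open>Invariance must be checked on all directed paths, also outside \<open>M\<close>.
    Since the image is itself invariant, the value \<open>None\<close> there is consistent.\<close>
  define f where "f z = (if z ` {0..1} \<subseteq> M then Some (natural_path z) else None)" for z
  have *: "f x = f y"
    using assms(1)
  proof (rule trace_equivalent_invariant)
    fix z \<phi> assume z: "z \<in> dpaths X" and \<phi>: "\<phi> \<in> Rep_plus"
    have "compose {0..1} z \<phi> ` {0..1} = z ` {0..1}" by (simp add: compose_image Rep_plusD(3)[OF \<phi>])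
    moreover have "natural_path (compose {0..1} z \<phi>) = natural_path z" if "z ` {0..1} \<subseteq> M"
      using natural_path_compose[OF _ \<phi>] z dpaths_subset that by (auto simp: paths_within_def)
    ultimately show "f (compose {0..1} z \<phi>) = f z" by (simp add: f_def)
  qed
  have "x ` {0..1} \<subseteq> M" using assms(2) by (simp add: paths_within_def)
  then show ?thesis using * trace_equivalent_image[OF assms(1)] by (simp add: f_def)
qed

text \<open>A reparametrization of the natural path is the directed path \<open>x\<close>, so
  saturation makes the natural path directed.\<close>

lemma natural_path_trace:
  assumes "x \<in> dpaths_between X u v" "x \<in> paths_within"
  shows "natural_path x \<in> dpaths_between X u v" "trace_equivalent X (natural_path x) x"
proof -
  obtain \<phi> where \<phi>: "\<phi> \<in> Rep_plus" "compose {0..1} (natural_path x) \<phi> = x"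
    using natural_path_factorization[OF assms(2)] by blast
  have "natural_path x \<in> paths_in (uspace X)"
    using natural_path_in_paths_within[OF assms(2)] paths_within_subset by blast
  then show D: "natural_path x \<in> dpaths_between X u v"
    using compose_Rep_plus_in_dpaths_between_iff[OF _ \<phi>(1)] \<phi>(2) assms(1) by metis
  then have "natural_path x \<in> dpaths X" by (simp add: dpaths_between_def)
  from trace_equivalent_step[OF this \<phi>(1)] show "trace_equivalent X (natural_path x) x" unfolding \<phi>(2) .
qed

definition natural_lift :: "('b \<Rightarrow> (real \<Rightarrow> 'a) set) \<Rightarrow> 'b \<Rightarrow> real \<Rightarrow> 'a" where
  "natural_lift h w = natural_path (SOME x. x \<in> h w)"

context
  fixes Z :: "'b topology" and h :: "'b \<Rightarrow> (real \<Rightarrow> 'a) set" and u v :: 'a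
  assumes h: "continuous_map Z (trace_space X u v) h" and M: "support (topspace Z) h \<subseteq> M"
begin

lemma trace_member:
  assumes w: "w \<in> topspace Z" and x: "x \<in> h w"
  shows "x \<in> dpaths_between X u v" "x \<in> paths_within" "h w = trace_of X u v x"
    "natural_lift h w = natural_path x"
proof -
  obtain z where z: "z \<in> dpaths_between X u v" "h w = trace_of X u v z"
    by (rule continuous_map_into_trace_spaceE[OF h w])
  have mem: "y \<in> dpaths_between X u v" "y \<in> paths_within" "h w = trace_of X u v y" if y: "y \<in> h w" for y
  proof -
    have yz: "y \<in> dpaths_between X u v" "trace_equivalent X z y" using y z(2) by (auto simp: trace_of_def)
    then show "y \<in> dpaths_between X u v" "h w = trace_of X u v y" using z trace_of_eq_iff[OF z(1) yz(1)] by auto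
    have "y ` {0..1} \<subseteq> support (topspace Z) h" unfolding support_def using w y by blast
    then have "y ` {0..1} \<subseteq> M" using M by (rule subset_trans)
    then show "y \<in> paths_within" using subsetD[OF dpaths_between_subset yz(1)] by (simp add: paths_within_def)
  qed
  show x1: "x \<in> dpaths_between X u v" "x \<in> paths_within" "h w = trace_of X u v x" by (rule mem[OF x])+
  define y where "y = (SOME x. x \<in> h w)"
  have y: "y \<in> h w" unfolding y_def by (rule someI[of "\<lambda>z. z \<in> h w", OF x])
  have "trace_equivalent X y x"
    using trace_of_eq_iff[OF mem(1)[OF y] x1(1)] mem(3)[OF y] x1(3) by simp
  then show "natural_lift h w = natural_path x"
    unfolding natural_lift_def y_def[symmetric]
    by (rule natural_path_eq_if_trace_equivalent) (rule mem(2)[OF y])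
qed

lemma natural_lift:
  assumes w: "w \<in> topspace Z"
  shows "natural_lift h w \<in> dpaths_between X u v" "trace_of X u v (natural_lift h w) = h w"
proof -
  obtain x where x: "x \<in> dpaths_between X u v" "h w = trace_of X u v x"
    by (rule continuous_map_into_trace_spaceE[OF h w])
  then have xh: "x \<in> h w" using mem_trace_of by simp
  note m = trace_member[OF w xh]
  show D: "natural_lift h w \<in> dpaths_between X u v"
    unfolding m(4) by (rule natural_path_trace(1)[OF m(1,2)])
  show "trace_of X u v (natural_lift h w) = h w"
    using natural_path_trace(2)[OF m(1,2)] trace_of_eq_iff[OF D m(1)] unfolding m(4) x(2) by simp
qed

text \<open>All members of \<open>h w\<close> have the same natural path, so that path lies in
  \<open>V\<close> exactly when \<open>h w\<close> meets \<open>V'\<close>. Lower semicontinuity of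
  \<open>h\<close> does the rest.\<close>

lemma continuous_map_natural_lift: "continuous_map Z CO (natural_lift h)"
  unfolding continuous_map_def
proof (intro conjI allI impI Pi_I)
  fix w assume "w \<in> topspace Z"
  then show "natural_lift h w \<in> topspace CO"
    using natural_lift(1) dpaths_between_subset by (auto simp: topspace_compact_open)
next
  fix V assume V: "openin CO V"
  have top: "topspace (subtopology CO paths_within) = paths_within"
    using paths_within_subset by (auto simp: topspace_compact_open)
  have "openin (subtopology CO paths_within) {x \<in> paths_within. natural_path x \<in> V}"
    using openin_continuous_map_preimage[OF continuous_map_natural_path V] unfolding top .
  then obtain V' where V': "openin CO V'" "{x \<in> paths_within. natural_path x \<in> V} = V' \<inter> paths_within"
    unfolding openin_subtopology by blast
  have "natural_lift h w \<in> V \<longleftrightarrow> h w \<inter> V' \<noteq> {}" if w: "w \<in> topspace Z" for w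
  proof -
    obtain x where x: "x \<in> dpaths_between X u v" "h w = trace_of X u v x"
      by (rule continuous_map_into_trace_spaceE[OF h w])
    then have xh: "x \<in> h w" using mem_trace_of by simp
    have iff: "natural_lift h w \<in> V \<longleftrightarrow> y \<in> V'" if "y \<in> h w" for y
      using trace_member[OF w that] V'(2) by (metis (mono_tags, lifting) IntD1 IntI mem_Collect_eq)
    show ?thesis using iff xh by blast
  qed
  then have "{w \<in> topspace Z. natural_lift h w \<in> V} = {w \<in> topspace Z. h w \<inter> V' \<noteq> {}}" by blast
  then show "openin Z {w \<in> topspace Z. natural_lift h w \<in> V}"
    using openin_preimage_of_saturation[OF h V'(1)] by simp
qed

end

end

end

section \<open>Extending a boundary lift over the disk\<close>

lemma radial_projection_boundary: "radius n w = 1 \<Longrightarrow> radial_projection n w = w"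
  by (simp add: radial_projection_def fun_eq_iff)

lemma continuous_map_radius: "continuous_map (disk n) euclideanreal (radius n)"
  by (simp add: disk_eq continuous_on_radius)

lemma boundary_sphere_subset_disk: "topspace (boundary_sphere n) \<subseteq> topspace (disk n)"
  by (auto simp: topspace_disk topspace_boundary_sphere)

context saturated_dspace begin

context
  fixes n :: nat and u v :: 'a and g :: "(nat \<Rightarrow> real) \<Rightarrow> real \<Rightarrow> 'a" and h :: "(nat \<Rightarrow> real) \<Rightarrow> (real \<Rightarrow> 'a) set"
    and e :: "'a \<Rightarrow> nat \<Rightarrow> real"
  assumes g: "continuous_map (boundary_sphere n) (dpath_space X u v) g"
    and h: "continuous_map (disk n) (trace_space X u v) h"
    and gh: "\<And>z. z \<in> topspace (boundary_sphere n) \<Longrightarrow> trace_of X u v (g z) = h z"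
    and embedded: "embedded_subspace (uspace X) (support (topspace (disk n)) h) e"
begin

interpretation embedded_subspace "uspace X" "support (topspace (disk n)) h" e by (rule embedded)

private abbreviation "lift \<equiv> natural_lift e h"

text \<open>The cone of the parameters of the boundary paths, before normalization: the homotopy from the
  identity to \<open>path_length e (g z)\<close> along the radius through \<open>z\<close>.\<close>

definition cone_length :: "(nat \<Rightarrow> real) \<Rightarrow> real \<Rightarrow> real" where
  "cone_length w t = (1 - radius n w) * t + radius n w * path_length (g (radial_projection n w)) t"

text \<open>The identity is the right default: total length 0 occurs only over a constant boundary
  path, which every parameter reproduces.\<close>

definition cone_parameter :: "(nat \<Rightarrow> real) \<Rightarrow> real \<Rightarrow> real" where
  "cone_parameter w = restrict (\<lambda>t. if cone_length w 1 = 0 then t else cone_length w t / cone_length w 1) {0..1}"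

lemma boundary_path:
  assumes z: "z \<in> topspace (boundary_sphere n)"
  shows "g z \<in> paths_within" "g z \<in> paths_in (uspace X)" "lift z = natural_path (g z)"
proof -
  have "g z \<in> topspace (dpath_space X u v)"
    using z continuous_map_funspace[OF g] by (rule funcset_mem[rotated])
  then have "g z \<in> dpaths_between X u v" by simp
  then have gz: "g z \<in> h z" using gh[OF z] mem_trace_of by metis
  have z': "z \<in> topspace (disk n)" using z boundary_sphere_subset_disk by blast
  note m = trace_member[OF embedded h, OF subset_refl z' gz]
  show "g z \<in> paths_within" "lift z = natural_path (g z)" by (rule m)+
  then show "g z \<in> paths_in (uspace X)" using paths_within_subset by blast
qed

lemma continuous_map_boundary: "continuous_map (boundary_sphere n) CO g"
  using continuous_map_k_Delta_imp[OF g[unfolded dpath_space_def]]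
  by (simp add: continuous_map_in_subtopology)

lemma cone_length_0 [simp]: "cone_length w 0 = 0"
  by (simp add: cone_length_def)

lemma cone_length_mono:
  assumes "w \<in> topspace (disk n)" "0 \<le> s" "s \<le> t"
  shows "cone_length w s \<le> cone_length w t"
  unfolding cone_length_def using assms radius_nonneg[of n w]
  by (intro add_mono mult_left_mono path_length_mono) (auto simp: topspace_disk)

lemma cone_length_nonneg: "w \<in> topspace (disk n) \<Longrightarrow> 0 \<le> t \<Longrightarrow> 0 \<le> cone_length w t"
  using cone_length_mono[of w 0 t] by simp

lemma continuous_on_cone_length:
  assumes w: "w \<in> topspace (disk n)" shows "continuous_on {0..1} (cone_length w)"
proof (cases "radius n w = 0")
  case True
  then show ?thesis by (simp add: cone_length_def[abs_def])
next
  case False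
  then have "g (radial_projection n w) \<in> paths_within"
    by (intro boundary_path radial_projection_in_boundary_sphere[OF w])
  then show ?thesis unfolding cone_length_def[abs_def]
    by (intro continuous_intros continuous_on_path_length)
qed

text \<open>At radius below 1 the identity contributes the positive amount
  \<open>1 - radius n w\<close> to the total length, so degenerate points lie on the sphere. This is
  the gain from contracting before normalizing.\<close>

lemma cone_length_eq_0:
  assumes w: "w \<in> topspace (disk n)" and eq: "cone_length w 1 = 0"
  shows "w \<in> topspace (boundary_sphere n)" "path_length (g w) 1 = 0"
proof -
  have r: "0 \<le> radius n w" "radius n w \<le> 1" using w radius_nonneg by (auto simp: topspace_disk)
  have "0 \<le> radius n w * path_length (g (radial_projection n w)) 1"
    using r path_length_nonneg by simp
  then have r1: "radius n w = 1" using eq r by (simp add: cone_length_def)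
  then show "w \<in> topspace (boundary_sphere n)"
    using w by (simp add: topspace_disk topspace_boundary_sphere)
  show "path_length (g w) 1 = 0"
    using eq r1 radial_projection_boundary[OF r1] by (simp add: cone_length_def)
qed

lemma cone_parameter_in_Rep_plus:
  assumes w: "w \<in> topspace (disk n)" shows "cone_parameter w \<in> Rep_plus"
proof (cases "cone_length w 1 = 0")
  case True
  then show ?thesis using Rep_plus_id by (simp add: cone_parameter_def)
next
  case False
  then have pos: "0 < cone_length w 1" using cone_length_nonneg[OF w, of 1] by simp
  have "restrict (\<lambda>t. cone_length w t / cone_length w 1) {0..1} \<in> Rep_plus"
  proof (rule Rep_plusI)
    show "mono_on {0..1} (\<lambda>t. cone_length w t / cone_length w 1)"
      using pos by (intro mono_onI divide_right_mono cone_length_mono[OF w]) auto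
    show "continuous_on {0..1} (\<lambda>t. cone_length w t / cone_length w 1)"
      by (intro continuous_intros continuous_on_cone_length[OF w]) (use False in simp)
  qed (use False in auto)
  then show ?thesis using False by (simp add: cone_parameter_def)
qed

lemma cone_length_locally_close:
  assumes w0: "w0 \<in> topspace (disk n)" and \<eta>: "\<eta> > 0"
  shows "\<exists>O'. openin (disk n) O' \<and> w0 \<in> O' \<and> (\<forall>w\<in>O'. \<forall>t\<in>{0..1}. \<bar>cone_length w t - cone_length w0 t\<bar> \<le> \<eta>)"
proof (cases "radius n w0 = 0")
  case True
  \<comment> \<open>The radial projection has no limit at the centre. Lengths and \<open>t\<close>
    both lie between 0 and 1, so the deviation from the identity is at most the radius.\<close>
  let ?O = "{w \<in> topspace (disk n). radius n w \<in> {..<\<eta>}}"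
  have "openin (disk n) ?O"
    by (rule openin_continuous_map_preimage[OF continuous_map_radius]) auto
  moreover have "w0 \<in> ?O" using w0 True \<eta> by simp
  moreover have "\<bar>cone_length w t - cone_length w0 t\<bar> \<le> \<eta>" if w: "w \<in> ?O" and t: "t \<in> {0..1}" for w t
  proof -
    let ?l = "path_length (g (radial_projection n w)) t"
    have "cone_length w t - cone_length w0 t = radius n w * (?l - t)"
      using True by (simp add: cone_length_def algebra_simps)
    moreover have "\<bar>?l - t\<bar> \<le> 1"
      using path_length_nonneg[of t] path_length_le_1[of t] t by (smt (verit) atLeastAtMost_iff)
    then have "radius n w * \<bar>?l - t\<bar> \<le> radius n w * 1"
      by (rule mult_left_mono[OF _ radius_nonneg])
    ultimately show ?thesis using w radius_nonneg[of n w] by (simp add: abs_mult)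
  qed
  ultimately show ?thesis by blast
next
  case False
  let ?N = "subtopology (disk n) {w. radius n w \<noteq> 0}"
  let ?p = "radial_projection n"
  have p0: "g (?p w0) \<in> paths_within"
    by (intro boundary_path radial_projection_in_boundary_sphere[OF w0 False])
  obtain V where V: "openin CO V" "g (?p w0) \<in> V"
    and close: "\<And>x t. x \<in> V \<inter> paths_within \<Longrightarrow> t \<in> {0..1} \<Longrightarrow> \<bar>path_length x t - path_length (g (?p w0)) t\<bar> \<le> \<eta>/2"
    using path_length_continuous[OF p0, of "\<eta>/2"] \<eta> by auto
  have N_open: "openin (disk n) {w \<in> topspace (disk n). radius n w \<in> - {0}}"
    by (rule openin_continuous_map_preimage[OF continuous_map_radius]) auto
  have N_eq: "{w \<in> topspace (disk n). radius n w \<in> - {0}} = topspace ?N" by auto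
  have "continuous_map ?N CO (g \<circ> ?p)"
    by (rule continuous_map_compose[OF continuous_map_radial_projection continuous_map_boundary])
  then have "openin ?N {w \<in> topspace ?N. (g \<circ> ?p) w \<in> V}"
    by (rule openin_continuous_map_preimage[OF _ V(1)])
  then have "openin (subtopology (disk n) (topspace ?N)) {w \<in> topspace ?N. (g \<circ> ?p) w \<in> V}"
    by (metis subtopology_restrict topspace_subtopology)
  then have O1: "openin (disk n) {w \<in> topspace ?N. (g \<circ> ?p) w \<in> V}"
    by (rule openin_trans_full) (use N_open N_eq in simp)
  have O2: "openin (disk n) {w \<in> topspace (disk n). radius n w \<in> ball (radius n w0) (\<eta>/4)}"
    by (rule openin_continuous_map_preimage[OF continuous_map_radius]) auto
  let ?O = "{w \<in> topspace ?N. (g \<circ> ?p) w \<in> V} \<inter> {w \<in> topspace (disk n). radius n w \<in> ball (radius n w0) (\<eta>/4)}"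
  have "openin (disk n) ?O" by (rule openin_Int[OF O1 O2])
  moreover have "w0 \<in> ?O" using w0 False V(2) \<eta> by simp
  moreover have "\<bar>cone_length w t - cone_length w0 t\<bar> \<le> \<eta>" if w: "w \<in> ?O" and t: "t \<in> {0..1}" for w t
  proof -
    let ?r = "radius n w" and ?r' = "radius n w0"
    let ?l = "path_length (g (?p w)) t" and ?l' = "path_length (g (?p w0)) t"
    have wd: "w \<in> topspace (disk n)" "?r \<noteq> 0" using w by auto
    have r: "0 \<le> ?r" "?r \<le> 1" using wd radius_nonneg by (auto simp: topspace_disk)
    have rr: "\<bar>?r - ?r'\<bar> \<le> \<eta>/4" using w by (auto simp: dist_real_def abs_minus_commute)
    have "g (?p w) \<in> V \<inter> paths_within"
      using w boundary_path(1)[OF radial_projection_in_boundary_sphere[OF wd]] by simp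
    then have ll: "\<bar>?l - ?l'\<bar> \<le> \<eta>/2" using close t by blast
    have l0: "\<bar>?l'\<bar> \<le> 1" using path_length_nonneg[of t] path_length_le_1[of t] t by simp
    \<comment> \<open>The three terms are bounded by \<open>\<eta>/4\<close>,
      \<open>\<eta>/2\<close> and \<open>\<eta>/4\<close>.\<close>
    have "cone_length w t - cone_length w0 t = (?r' - ?r) * t + ?r * (?l - ?l') + (?r - ?r') * ?l'"
      by (simp add: cone_length_def algebra_simps)
    moreover have "\<bar>(?r' - ?r) * t\<bar> \<le> (\<eta>/4) * 1"
      unfolding abs_mult using rr t \<eta> by (intro mult_mono) (auto simp: abs_minus_commute)
    moreover have "\<bar>?r * (?l - ?l')\<bar> \<le> 1 * (\<eta>/2)"
      unfolding abs_mult using r ll by (intro mult_mono) auto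
    moreover have "\<bar>(?r - ?r') * ?l'\<bar> \<le> (\<eta>/4) * 1"
      unfolding abs_mult using rr l0 \<eta> by (intro mult_mono) auto
    ultimately show ?thesis by linarith
  qed
  ultimately show ?thesis by blast
qed

lemma cone_parameter_locally_close:
  assumes w0: "w0 \<in> topspace (disk n)" and pos: "cone_length w0 1 \<noteq> 0" and \<epsilon>: "\<epsilon> > 0"
  shows "\<exists>O'. openin (disk n) O' \<and> w0 \<in> O' \<and> (\<forall>w\<in>O'. \<forall>t\<in>{0..1}. \<bar>cone_parameter w t - cone_parameter w0 t\<bar> \<le> \<epsilon>)"
proof -
  define L where "L = cone_length w0 1"
  have L: "0 < L" using cone_length_nonneg[OF w0, of 1] pos by (simp add: L_def)
  define \<eta> where "\<eta> = min (L/4) (L * \<epsilon> / 4)"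
  have \<eta>: "\<eta> > 0" "\<eta> \<le> L/4" "4 * \<eta> / L \<le> \<epsilon>"
    using L \<epsilon> by (auto simp: \<eta>_def field_simps min_def)
  obtain O' where O': "openin (disk n) O'" "w0 \<in> O'"
    and close: "\<And>w t. w \<in> O' \<Longrightarrow> t \<in> {0..1} \<Longrightarrow> \<bar>cone_length w t - cone_length w0 t\<bar> \<le> \<eta>"
    using cone_length_locally_close[OF w0 \<eta>(1)] by blast
  have "\<bar>cone_parameter w t - cone_parameter w0 t\<bar> \<le> \<epsilon>" if w: "w \<in> O'" and t: "t \<in> {0..1}" for w t
  proof -
    have "\<bar>cone_length w 1 - L\<bar> \<le> \<eta>" using close[OF w, of 1] by (simp add: L_def)
    then have "cone_length w 1 \<noteq> 0" using \<eta> L by auto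
    then have "\<bar>cone_parameter w t - cone_parameter w0 t\<bar> = \<bar>cone_length w t / cone_length w 1 - cone_length w0 t / L\<bar>"
      using pos t by (simp add: cone_parameter_def L_def)
    also have "\<dots> \<le> 4 * \<eta> / L"
      by (rule normalized_quotient_close[OF close[OF w t]])
        (use close[OF w, of 1] \<eta> L t cone_length_nonneg[OF w0] cone_length_mono[OF w0] in \<open>auto simp: L_def\<close>)
    finally show ?thesis using \<eta>(3) by linarith
  qed
  then show ?thesis using O' by blast
qed

definition cone_lift :: "(nat \<Rightarrow> real) \<Rightarrow> real \<Rightarrow> 'a" where
  "cone_lift w = compose {0..1} (lift w) (cone_parameter w)"

lemma cone_lift_trace:
  assumes w: "w \<in> topspace (disk n)"
  shows "cone_lift w \<in> dpaths_between X u v" "trace_of X u v (cone_lift w) = h w"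
proof -
  note lift = natural_lift[OF embedded h subset_refl w]
  have lp: "lift w \<in> paths_in (uspace X)" using lift(1) dpaths_between_subset by (rule subsetD[rotated])
  show D: "cone_lift w \<in> dpaths_between X u v"
    unfolding cone_lift_def using compose_Rep_plus_in_dpaths_between_iff[OF lp cone_parameter_in_Rep_plus[OF w]] lift(1) by simp
  have "lift w \<in> dpaths X" using lift(1) by (simp add: dpaths_between_def)
  from trace_equivalent_step[OF this cone_parameter_in_Rep_plus[OF w]]
  have "trace_of X u v (lift w) = trace_of X u v (cone_lift w)"
    using trace_of_eq_iff[OF lift(1) D] by (simp add: cone_lift_def)
  then show "trace_of X u v (cone_lift w) = h w" using lift(2) by simp
qed

text \<open>At radius 1 the cone length is the length of \<open>g z\<close>, so the parameter is the
  one that recovers \<open>g z\<close> from its natural path; at length 0 both factors are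
  trivial.\<close>

lemma cone_lift_boundary:
  assumes z: "z \<in> topspace (boundary_sphere n)" shows "cone_lift z = g z"
proof -
  note gz = boundary_path[OF z]
  have r1: "radius n z = 1" using z by (simp add: topspace_boundary_sphere)
  have cl: "cone_length z t = path_length (g z) t" for t
    by (simp add: cone_length_def r1 radial_projection_boundary[OF r1])
  show ?thesis
  proof (cases "path_length (g z) 1 = 0")
    case True
    then have "cone_lift z = compose {0..1} (g z) (restrict (\<lambda>t. t) {0..1})"
      by (simp add: cone_lift_def cone_parameter_def cl gz(3) natural_path_def)
    also have "\<dots> = g z"
      by (rule extensionalityI[of _ "{0..1}"]) (use gz(2) in \<open>auto simp: compose_def paths_in_def\<close>)
    finally show ?thesis .
  next
    case False
    then show ?thesis
      unfolding cone_lift_def gz(3)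
      by (intro compose_natural_path gz(1)) (simp_all add: cone_parameter_def cl)
  qed
qed

text \<open>Where the total length is positive, the parameter varies continuously and thickening
  absorbs its variation. Where it vanishes, the parameter is uncontrolled, but
  \<open>lift w0\<close> is constant and nearby lifts send the whole interval into
  \<open>U\<close>.\<close>

lemma continuous_map_cone_lift: "continuous_map (disk n) CO cone_lift"
proof (rule continuous_map_into_compact_open)
  show "cone_lift ` topspace (disk n) \<subseteq> paths_in (uspace X)"
    using cone_lift_trace(1) dpaths_between_subset by blast
  fix K :: "real set" and U assume K: "compact K" "K \<subseteq> {0..1}" and U: "openin (uspace X) U"
  have lift_open: "openin (disk n) {w \<in> topspace (disk n). lift w ` C \<subseteq> U}" if "compact C" "C \<subseteq> {0..1}" for C
  proof -
    have "openin (disk n) {w \<in> topspace (disk n). lift w \<in> {x \<in> paths_in (uspace X). x ` C \<subseteq> U}}"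
      by (rule openin_continuous_map_preimage[OF continuous_map_natural_lift[OF embedded h subset_refl]])
        (rule openin_compact_open_subbasic[OF that U])
    moreover have "lift w \<in> paths_in (uspace X)" if "w \<in> topspace (disk n)" for w
      using natural_lift(1)[OF embedded h subset_refl that] dpaths_between_subset by (rule subsetD[rotated])
    then have "{w \<in> topspace (disk n). lift w \<in> {x \<in> paths_in (uspace X). x ` C \<subseteq> U}} =
        {w \<in> topspace (disk n). lift w ` C \<subseteq> U}" by blast
    ultimately show ?thesis by simp
  qed
  have image: "cone_lift w ` K = lift w ` cone_parameter w ` K" for w
    unfolding cone_lift_def by (rule compose_image[OF K(2)])
  have param_range: "cone_parameter w ` K \<subseteq> {0..1}" if "w \<in> topspace (disk n)" for w
    using Rep_plusD(3)[OF cone_parameter_in_Rep_plus[OF that]] K(2) by blast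
  show "openin (disk n) {w \<in> topspace (disk n). cone_lift w ` K \<subseteq> U}"
  proof (subst openin_subopen, intro ballI)
    fix w0 assume "w0 \<in> {w \<in> topspace (disk n). cone_lift w ` K \<subseteq> U}"
    then have w0: "w0 \<in> topspace (disk n)" and w0K: "lift w0 ` cone_parameter w0 ` K \<subseteq> U" by (auto simp: image)
    show "\<exists>T. openin (disk n) T \<and> w0 \<in> T \<and> T \<subseteq> {w \<in> topspace (disk n). cone_lift w ` K \<subseteq> U}"
    proof (cases "cone_length w0 1 = 0 \<and> K \<noteq> {}")
      case True
      note z = cone_length_eq_0[OF w0 conjunct1[OF True]]
      note gz = boundary_path[OF z(1)]
      obtain t where t: "t \<in> K" using True by blast
      \<comment> \<open>The total length vanishes only over a constant \<open>g w0\<close>, which is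
        its own natural path.\<close>
      have const: "lift w0 s = g w0 0" if "s \<in> {0..1}" for s
        using path_length_eq_0_imp_const[OF gz(1) z(2) that] z(2) gz(3) by (simp add: natural_path_def)
      have "cone_parameter w0 t \<in> {0..1}" using param_range[OF w0] t by blast
      then have "g w0 0 \<in> U" using const w0K t by (metis image_eqI subsetD)
      then have "lift w0 ` {0..1} \<subseteq> U" using const by auto
      then have "w0 \<in> {w \<in> topspace (disk n). lift w ` {0..1} \<subseteq> U}" using w0 by simp
      moreover have "{w \<in> topspace (disk n). lift w ` {0..1} \<subseteq> U} \<subseteq> {w \<in> topspace (disk n). cone_lift w ` K \<subseteq> U}"
        using param_range unfolding image by blast
      ultimately show ?thesis using lift_open[of "{0..1}"] by auto
    next
      case False
      show ?thesis
      proof (cases "K = {}")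
        case True
        then show ?thesis using w0 by (intro exI[of _ "topspace (disk n)"]) auto
      next
        case nonempty: False
        have lp: "lift w0 \<in> paths_in (uspace X)"
          using natural_lift(1)[OF embedded h subset_refl w0] dpaths_between_subset by (rule subsetD[rotated])
        have "compact (cone_parameter w0 ` K)"
          by (rule compact_continuous_image[OF continuous_on_subset[OF
                Rep_plusD(1)[OF cone_parameter_in_Rep_plus[OF w0]] K(2)] K(1)])
        then obtain C \<epsilon> where C: "compact C" "C \<subseteq> {0..1}" "lift w0 ` C \<subseteq> U" and \<epsilon>: "\<epsilon> > 0"
          and near: "\<And>s s'. s \<in> cone_parameter w0 ` K \<Longrightarrow> s' \<in> {0..1} \<Longrightarrow> \<bar>s' - s\<bar> \<le> \<epsilon> \<Longrightarrow> s' \<in> C"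
          by (rule path_compact_thickening[OF lp U _ param_range[OF w0] w0K]) blast
        obtain O' where O': "openin (disk n) O'" "w0 \<in> O'"
          and close: "\<And>w t. w \<in> O' \<Longrightarrow> t \<in> {0..1} \<Longrightarrow> \<bar>cone_parameter w t - cone_parameter w0 t\<bar> \<le> \<epsilon>"
          using cone_parameter_locally_close[OF w0 _ \<epsilon>] False nonempty by blast
        let ?T = "O' \<inter> {w \<in> topspace (disk n). lift w ` C \<subseteq> U}"
        have "openin (disk n) ?T" by (intro openin_Int O' lift_open C)
        moreover have "w0 \<in> ?T" using O'(2) w0 C(3) by blast
        moreover have "?T \<subseteq> {w \<in> topspace (disk n). cone_lift w ` K \<subseteq> U}"
        proof
          fix w assume w: "w \<in> ?T"
          have wd: "w \<in> topspace (disk n)" using w by blast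
          have "cone_parameter w ` K \<subseteq> C"
          proof
            fix s' assume "s' \<in> cone_parameter w ` K"
            then obtain t where t: "t \<in> K" "s' = cone_parameter w t" by blast
            show "s' \<in> C"
            proof (rule near)
              show "cone_parameter w0 t \<in> cone_parameter w0 ` K" using t(1) by blast
              show "s' \<in> {0..1}" using param_range[OF wd] t by blast
              show "\<bar>s' - cone_parameter w0 t\<bar> \<le> \<epsilon>" using close[of w t] w t K(2) by blast
            qed
          qed
          then have "cone_lift w ` K \<subseteq> U" unfolding image using w by blast
          then show "w \<in> {w \<in> topspace (disk n). cone_lift w ` K \<subseteq> U}" using wd by simp
        qed
        ultimately show ?thesis by blast
      qed
    qed
  qed
qed

lemma disk_lifting:
  "\<exists>l. continuous_map (disk n) (dpath_space X u v) l \<and>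
    (\<forall>z \<in> topspace (boundary_sphere n). l z = g z) \<and> (\<forall>w \<in> topspace (disk n). trace_of X u v (l w) = h w)"
proof (intro exI[of _ cone_lift] conjI ballI)
  show "continuous_map (disk n) (dpath_space X u v) cone_lift"
    unfolding dpath_space_def
  proof (rule continuous_map_disk_k_Delta)
    show "continuous_map (disk n) (subtopology CO (dpaths_between X u v)) cone_lift"
      using continuous_map_cone_lift cone_lift_trace(1) by (auto simp: continuous_map_in_subtopology)
  qed
qed (rule cone_lift_boundary cone_lift_trace(2), assumption)+

end

lemma right_lifting_property_trace_of:
  "right_lifting_property (dpath_space X u v) (trace_space X u v) (trace_of X u v) (boundary_sphere n) (disk n) (\<lambda>z. z)"
  unfolding right_lifting_property_def
proof (intro allI impI)
  fix g h
  assume asm: "continuous_map (boundary_sphere n) (dpath_space X u v) g \<and> continuous_map (disk n) (trace_space X u v) h \<and>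
    (\<forall>z\<in>topspace (boundary_sphere n). trace_of X u v (g z) = h z)"
  then obtain e where "embedded_subspace (uspace X) (support (topspace (disk n)) h) e"
    using compactin_embedding[OF compactin_support[OF compact_space_disk]] by blast
  from disk_lifting[OF _ _ _ this] asm
  show "\<exists>l. continuous_map (disk n) (dpath_space X u v) l \<and>
      (\<forall>z\<in>topspace (boundary_sphere n). l z = g z) \<and> (\<forall>w\<in>topspace (disk n). trace_of X u v (l w) = h w)"
    by blast
qed

end

section \<open>Separation in the path and trace spaces\<close>

lemma Hausdorff_compact_open:
  assumes "Hausdorff_space Y" shows "Hausdorff_space (compact_open_topology Y)"
  unfolding Hausdorff_space_def
proof (intro allI impI)
  fix x y assume "x \<in> topspace (compact_open_topology Y) \<and> y \<in> topspace (compact_open_topology Y) \<and> x \<noteq> y"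
  then have x: "x \<in> paths_in Y" and y: "y \<in> paths_in Y" and ne: "x \<noteq> y" by (auto simp: topspace_compact_open)
  obtain t where t: "t \<in> {0..1}" "x t \<noteq> y t" using paths_in_ext[OF x y] ne by blast
  obtain U V where UV: "openin Y U" "openin Y V" "x t \<in> U" "y t \<in> V" "disjnt U V"
    using assms t(2) paths_in_range[OF x t(1)] paths_in_range[OF y t(1)]
    unfolding Hausdorff_space_def by blast
  let ?S = "\<lambda>U. {x \<in> paths_in Y. x ` {t} \<subseteq> U}"
  have "openin (compact_open_topology Y) (?S W)" if "openin Y W" for W
    by (rule openin_compact_open_subbasic) (use t(1) that in auto)
  then have "openin (compact_open_topology Y) (?S U)" "openin (compact_open_topology Y) (?S V)"
    using UV by blast+
  moreover have "x \<in> ?S U" "y \<in> ?S V" using x y UV by auto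
  moreover have "disjnt (?S U) (?S V)" using UV(5) by (auto simp: disjnt_def)
  ultimately show "\<exists>U V. openin (compact_open_topology Y) U \<and> openin (compact_open_topology Y) V \<and>
      x \<in> U \<and> y \<in> V \<and> disjnt U V"
    by blast
qed

lemma Hausdorff_k_Delta: "Hausdorff_space Y \<Longrightarrow> Hausdorff_space (k_Delta Y)"
  unfolding Hausdorff_space_def topspace_k_Delta by (meson openin_imp_openin_k_Delta)

lemma Hausdorff_imp_Delta_Hausdorff:
  assumes "Hausdorff_space Y" shows "Delta_Hausdorff Y"
  unfolding Delta_Hausdorff_def
proof (intro allI impI)
  fix \<gamma> assume "pathin Y \<gamma>"
  then have "compactin Y (\<gamma> ` {0..1})"
    unfolding pathin_def by (intro image_compactin) (auto simp: compactin_subtopology)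
  then show "closedin Y (\<gamma> ` {0..1})" by (rule compactin_imp_closedin[OF assms])
qed

context saturated_dspace begin

lemma Delta_generated_dpath_space: "Delta_generated (dpath_space X u v)"
  unfolding dpath_space_def by (rule Delta_generated_k_Delta)

lemma Delta_Hausdorff_dpath_space: "Delta_Hausdorff (dpath_space X u v)"
  unfolding dpath_space_def
  by (intro Hausdorff_imp_Delta_Hausdorff Hausdorff_k_Delta Hausdorff_space_subtopology
      Hausdorff_compact_open Hausdorff)

lemma Delta_generated_trace_space: "Delta_generated (trace_space X u v)"
  unfolding trace_space_def
  by (rule Delta_generated_final_topology[OF Delta_generated_dpath_space]) simp

text \<open>In \<open>k_Delta\<close> spaces closedness is tested on simplices \<open>f\<close>, and the traces of \<open>f\<close> and of \<open>\<gamma>\<close> together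
  have compact support, on which natural parametrizations decide trace equivalence.\<close>

lemma Delta_Hausdorff_trace_space: "Delta_Hausdorff (trace_space X u v)"
  unfolding Delta_Hausdorff_def
proof (intro allI impI)
  fix \<gamma> :: "real \<Rightarrow> (real \<Rightarrow> 'a) set" assume "pathin (trace_space X u v) \<gamma>"
  then have \<gamma>: "continuous_map (top_of_set {0..1}) (trace_space X u v) \<gamma>" by (simp add: pathin_def)
  let ?I = "top_of_set {0..1::real}"
  let ?D = "dpaths_between X u v"
  let ?C = "{x \<in> ?D. trace_of X u v x \<in> \<gamma> ` {0..1}}"
  have sub: "\<gamma> ` {0..1} \<subseteq> topspace (trace_space X u v)"
    using continuous_map_image_subset_topspace[OF \<gamma>] by simp
  have "openin (dpath_space X u v) (?D - ?C)"
    unfolding dpath_space_def openin_k_Delta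
  proof (intro conjI allI impI)
    show "?D - ?C \<subseteq> topspace (subtopology CO ?D)"
      using dpaths_between_subset by (auto simp: topspace_compact_open)
    fix m f assume f: "continuous_map (simplex_space m) (subtopology CO ?D) f"
    have fD: "f a \<in> ?D" if "a \<in> topspace (simplex_space m)" for a
      using that continuous_map_funspace[OF f] by (auto simp: Pi_iff)
    have "continuous_map (simplex_space m) (dpath_space X u v) f"
      unfolding dpath_space_def continuous_map_simplex_k_Delta by (rule f)
    then have qf: "continuous_map (simplex_space m) (trace_space X u v) (trace_of X u v \<circ> f)"
      by (rule continuous_map_compose[OF _ continuous_map_trace_of])
    have I: "compact_space ?I" by (simp add: compact_space_subtopology)
    \<comment> \<open>One compact set for both maps means one embedding and one notion of natural
      path, so the two lifts can be compared.\<close>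
    define M where "M = support {0..1} \<gamma> \<union> support (topspace (simplex_space m)) (trace_of X u v \<circ> f)"
    have "compactin (uspace X) M"
      unfolding M_def using compactin_support[OF I \<gamma>] compactin_support[OF compact_space_simplex qf]
      by (intro compactin_Un) simp_all
    then obtain e where e: "embedded_subspace (uspace X) M e" by (rule compactin_embedding)
    have sub\<gamma>: "support (topspace ?I) \<gamma> \<subseteq> M"
      and subf: "support (topspace (simplex_space m)) (trace_of X u v \<circ> f) \<subseteq> M"
      by (auto simp: M_def)
    let ?s\<gamma> = "natural_lift e \<gamma>" and ?sf = "natural_lift e (trace_of X u v \<circ> f)"
    \<comment> \<open>The comparison is moved to the path space, which is Hausdorff, so the compact
      set of natural paths along \<gamma> is closed there.\<close>
    have "compactin CO (?s\<gamma> ` topspace ?I)"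
      by (rule image_compactin[OF I[unfolded compact_space_def] continuous_map_natural_lift[OF e \<gamma> sub\<gamma>]])
    then have "closedin CO (?s\<gamma> ` {0..1})"
      using compactin_imp_closedin[OF Hausdorff_compact_open[OF Hausdorff]] by simp
    then have "openin CO (topspace CO - ?s\<gamma> ` {0..1})" by blast
    then have "openin (simplex_space m) {a \<in> topspace (simplex_space m). ?sf a \<in> topspace CO - ?s\<gamma> ` {0..1}}"
      by (rule openin_continuous_map_preimage[OF continuous_map_natural_lift[OF e qf subf]])
    moreover have "?sf a \<in> topspace CO - ?s\<gamma> ` {0..1} \<longleftrightarrow> f a \<in> ?D - ?C" if a: "a \<in> topspace (simplex_space m)" for a
    proof -
      note lift_a = natural_lift[OF e qf subf a]
      have "?sf a \<in> ?s\<gamma> ` {0..1} \<longleftrightarrow> trace_of X u v (f a) \<in> \<gamma> ` {0..1}"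
      proof
        assume "?sf a \<in> ?s\<gamma> ` {0..1}"
        then obtain t where t: "t \<in> {0..1}" "?sf a = ?s\<gamma> t" by blast
        then have "trace_of X u v (f a) = \<gamma> t"
          using lift_a(2) natural_lift(2)[OF e \<gamma> sub\<gamma>, of t] by simp
        then show "trace_of X u v (f a) \<in> \<gamma> ` {0..1}" using t(1) by blast
      next
        assume "trace_of X u v (f a) \<in> \<gamma> ` {0..1}"
        then obtain t where t: "t \<in> {0..1}" "trace_of X u v (f a) = \<gamma> t" by blast
        \<comment> \<open>The lift at a point depends only on the trace at that point, hence agrees
          across the two domains.\<close>
        then have "?sf a = ?s\<gamma> t" by (simp add: natural_lift_def[OF e])
        then show "?sf a \<in> ?s\<gamma> ` {0..1}" using t(1) by blast
      qed
      moreover have "?sf a \<in> topspace CO"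
        using lift_a(1) dpaths_between_subset unfolding topspace_compact_open by (rule subsetD[rotated])
      ultimately show ?thesis using fD[OF a] by blast
    qed
    ultimately show "openin (simplex_space m) {z \<in> topspace (simplex_space m). f z \<in> ?D - ?C}"
      by (metis (mono_tags, lifting) Collect_cong)
  qed
  then have "closedin (dpath_space X u v) ?C" by (auto simp: closedin_def)
  then show "closedin (trace_space X u v) (\<gamma> ` {0..1})"
    using closedin_trace_space_iff[OF sub] by simp
qed

lemma trivial_q_fibration_trace_of:
  "trivial_q_fibration c (dpath_space X u v) (trace_space X u v) (trace_of X u v)"
  unfolding trivial_q_fibration_def
  using Delta_generated_dpath_space Delta_Hausdorff_dpath_space Delta_generated_trace_space
    Delta_Hausdorff_trace_space continuous_map_trace_of right_lifting_property_trace_of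
  by (cases c) auto

end

theorem theorem8p5:
  fixes c :: top_category
    and X :: "'a dspace"
    and u v :: 'a
  assumes "directed_space c X"
    and "saturated X"
    and "Hausdorff_space (uspace X)"
    and "second_countable (uspace X)"
    and "u \<in> topspace (uspace X)"
    and "v \<in> topspace (uspace X)"
  shows "trivial_q_fibration c (dpath_space X u v) (trace_space X u v) (trace_of X u v)
    \<and> Delta_Hausdorff (trace_space X u v)"
proof -
  interpret saturated_dspace c X
    using assms(1-4) by unfold_locales
  show ?thesis
    using trivial_q_fibration_trace_of Delta_Hausdorff_trace_space by blast
qed

end
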